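(* Let $\Omega\subset\mathbb{R}^2$ be a bounded domain with boundary parameterized by a smooth regular closed curve $\gamma:[0,L]\to\mathbb{R}^2$, let $k>0$, let $V:[0,L]\to\mathbb{R}^2$ be a smooth (periodic) deformation field, not necessarily normal, and consider the perturbed curve $\gamma_\varepsilon(s)=\gamma(s)+\varepsilon V(s)$. Then, for smooth densities $\sigma$, the shape derivative of $S_k'$ is given by $$\delta(S_k')[\sigma](t)=\int_0^L\big(U_1(t,s)+U_2(t,s)+U_3(t,s)\big)\,\sigma(s)\,|\dot\gamma(s)|\,ds,$$ where $$U_1(t,s)=R\frac{dV}{d\tau}(t)\cdot\nabla_xG_k(\gamma(t),\gamma(s)),$$ $$U_2(t,s)=n(t)\cdot\Big(\nabla_x^2G_k(\gamma(t),\gamma(s))\,(V(t)-V(s))\Big),$$ $$U_3(t,s)=\partial_{n_x}G_k(\gamma(t),\gamma(s))\Big(\tau(s)\cdot\frac{dV}{d\tau}(s)-\tau(t)\cdot\frac{dV}{d\tau}(t)\Big).$$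
   Context: $\tau=\dot\gamma/|\dot\gamma|$ is the unit tangent (counterclockwise orientation), $R$ denotes clockwise rotation by $\pi/2$, $n=R\tau$ is the outward unit normal, and $\frac{dV}{d\tau}=\dot V/|\dot\gamma|$ is the tangential (arc-length) derivative. $G_k(x,y)=\frac{i}{4}H_0^{(1)}(k|x-y|)$, with $H_0^{(1)}$ the Hankel function of the first kind of order $0$; $\nabla_x$ and $\nabla_x^2$ are the gradient and Hessian in the first argument, and $\partial_{n_x}G_k(\gamma(t),\gamma(s))=n(t)\cdot\nabla_xG_k(\gamma(t),\gamma(s))$. The operator is $$S_k'[\sigma](t)=\mathrm{p.v.}\int_0^L n(t)\cdot\nabla_xG_k(\gamma(t),\gamma(s))\,\sigma(s)\,|\dot\gamma(s)|\,ds,$$ with p.v. the Cauchy principal value, and $\delta(S_k')[\sigma](t)$ is the derivative at $\varepsilon=0$ of the same expression with $\gamma,n$ replaced by $\gamma_\varepsilon$ and its outward unit normal $n_\varepsilon$, the wavenumber $k$ and the function $s\mapsto\sigma(s)$ being held fixed. *)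

theory Defs
  imports "HOL-Complex_Analysis.Complex_Analysis"
begin

section \<open>The Helmholtz fundamental solution in the plane\<close>

text \<open>Bessel functions of order 0 on the positive half-line, by their ascending series
  (the \<open>m = 0\<close> term of the last sum vanishes, since \<open>harm 0 = 0\<close>).\<close>

definition bessel_J0 :: "real \<Rightarrow> real" where
  "bessel_J0 r = (\<Sum>m. (-1) ^ m * (r / 2) ^ (2 * m) / (fact m)\<^sup>2)"

definition bessel_Y0 :: "real \<Rightarrow> real" where
  "bessel_Y0 r = 2 / pi * (ln (r / 2) + euler_mascheroni) * bessel_J0 r
     - 2 / pi * (\<Sum>m. (-1) ^ m * harm m * (r / 2) ^ (2 * m) / (fact m)\<^sup>2)"

definition hankel1_0 :: "real \<Rightarrow> complex" where
  "hankel1_0 r = Complex (bessel_J0 r) (bessel_Y0 r)"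

definition helmholtz_G :: "real \<Rightarrow> real^2 \<Rightarrow> real^2 \<Rightarrow> complex" where
  "helmholtz_G k x y = \<i> / 4 * hankel1_0 (k * norm (x - y))"


section \<open>Gradients, Hessians and the bilinear dot product\<close>

definition gradient :: "(real^'n \<Rightarrow> complex) \<Rightarrow> real^'n \<Rightarrow> complex^'n" where
  "gradient f x = (\<chi> i. frechet_derivative f (at x) (axis i 1))"

definition hessian :: "(real^'n \<Rightarrow> complex) \<Rightarrow> real^'n \<Rightarrow> complex^'n^'n" where
  "hessian f x = (\<chi> i j. gradient (\<lambda>z. gradient f z $ j) x $ i)"

definition cvec :: "real^'n \<Rightarrow> complex^'n" where
  "cvec v = (\<chi> i. complex_of_real (v $ i))"

text \<open>The dot product of a real vector with a complex one; no complex conjugation is involved.\<close>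

definition dotc :: "real^'n \<Rightarrow> complex^'n \<Rightarrow> complex" where
  "dotc v w = (\<Sum>i\<in>UNIV. complex_of_real (v $ i) * w $ i)"

abbreviation grad_G :: "real \<Rightarrow> real^2 \<Rightarrow> real^2 \<Rightarrow> complex^2" where
  "grad_G k x y \<equiv> gradient (\<lambda>z. helmholtz_G k z y) x"

abbreviation hess_G :: "real \<Rightarrow> real^2 \<Rightarrow> real^2 \<Rightarrow> complex^2^2" where
  "hess_G k x y \<equiv> hessian (\<lambda>z. helmholtz_G k z y) x"


section \<open>Closed curves\<close>

text \<open>A smooth function on the closed parameter interval whose derivatives of all orders match at
  the end points is represented by its smooth \<open>L\<close>-periodic extension to the real line.\<close>

definition smooth :: "(real \<Rightarrow> 'a::real_normed_vector) \<Rightarrow> bool" where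
  "smooth f \<longleftrightarrow>
     (\<forall>n s. ((\<lambda>g u. vector_derivative g (at u)) ^^ n) f differentiable (at s))"

definition periodic :: "real \<Rightarrow> (real \<Rightarrow> 'a) \<Rightarrow> bool" where
  "periodic L f \<longleftrightarrow> (\<forall>s. f (s + L) = f s)"

definition velocity :: "(real \<Rightarrow> real^2) \<Rightarrow> real \<Rightarrow> real^2" where
  "velocity \<gamma> s = vector_derivative \<gamma> (at s)"

definition speed :: "(real \<Rightarrow> real^2) \<Rightarrow> real \<Rightarrow> real" where
  "speed \<gamma> s = norm (velocity \<gamma> s)"

definition unit_tangent :: "(real \<Rightarrow> real^2) \<Rightarrow> real \<Rightarrow> real^2" where
  "unit_tangent \<gamma> s = velocity \<gamma> s /\<^sub>R speed \<gamma> s"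

text \<open>Clockwise rotation by a right angle.\<close>

definition rot :: "real^2 \<Rightarrow> real^2" where
  "rot v = vector [v $ 2, - (v $ 1)]"

text \<open>This is the outward unit normal when \<open>\<gamma>\<close> is counterclockwise.\<close>

definition unit_normal :: "(real \<Rightarrow> real^2) \<Rightarrow> real \<Rightarrow> real^2" where
  "unit_normal \<gamma> s = rot (unit_tangent \<gamma> s)"

definition tangential_deriv :: "(real \<Rightarrow> real^2) \<Rightarrow> (real \<Rightarrow> real^2) \<Rightarrow> real \<Rightarrow> real^2" where
  "tangential_deriv \<gamma> V s = vector_derivative V (at s) /\<^sub>R speed \<gamma> s"

definition to_complex :: "real^2 \<Rightarrow> complex" where
  "to_complex v = Complex (v $ 1) (v $ 2)"

definition counterclockwise_around :: "real \<Rightarrow> (real \<Rightarrow> real^2) \<Rightarrow> (real^2) set \<Rightarrow> bool" where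
  "counterclockwise_around L \<gamma> \<Omega> \<longleftrightarrow>
     (\<forall>z\<in>\<Omega>. winding_number (\<lambda>u. to_complex (\<gamma> (L * u))) (to_complex z) = 1)"

definition perturbed :: "(real \<Rightarrow> real^2) \<Rightarrow> (real \<Rightarrow> real^2) \<Rightarrow> real \<Rightarrow> real \<Rightarrow> real^2" where
  "perturbed \<gamma> V \<epsilon> s = \<gamma> s + \<epsilon> *\<^sub>R V s"


section \<open>The principal value operator\<close>

text \<open>The integrand may be singular at the point \<open>\<gamma> t\<close>. The excluded neighbourhood is measured
  in the plane and not in the parameter, so that for \<open>t = 0\<close> or \<open>t = L\<close> it
  is cut out at both ends of the parameter interval.\<close>

definition truncated :: "real \<Rightarrow> (real \<Rightarrow> real^2) \<Rightarrow> real \<Rightarrow> real \<Rightarrow> real set" where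
  "truncated L \<gamma> t \<delta> = {s \<in> {0..L}. \<delta> < dist (\<gamma> t) (\<gamma> s)}"

definition has_pv_integral ::
    "real \<Rightarrow> (real \<Rightarrow> real^2) \<Rightarrow> real \<Rightarrow> (real \<Rightarrow> complex) \<Rightarrow> complex \<Rightarrow> bool" where
  "has_pv_integral L \<gamma> t f I \<longleftrightarrow>
     (\<forall>\<delta>>0. f absolutely_integrable_on truncated L \<gamma> t \<delta>) \<and>
     ((\<lambda>\<delta>. integral (truncated L \<gamma> t \<delta>) f) \<longlongrightarrow> I) (at_right 0)"

definition pv_integral ::
    "real \<Rightarrow> (real \<Rightarrow> real^2) \<Rightarrow> real \<Rightarrow> (real \<Rightarrow> complex) \<Rightarrow> complex" where
  "pv_integral L \<gamma> t f = (THE I. has_pv_integral L \<gamma> t f I)"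

definition S'_integrand ::
    "real \<Rightarrow> (real \<Rightarrow> real^2) \<Rightarrow> (real \<Rightarrow> complex) \<Rightarrow> real \<Rightarrow> real \<Rightarrow> complex" where
  "S'_integrand k \<gamma> \<sigma> t s =
     dotc (unit_normal \<gamma> t) (grad_G k (\<gamma> t) (\<gamma> s)) * \<sigma> s * complex_of_real (speed \<gamma> s)"

definition S' ::
    "real \<Rightarrow> real \<Rightarrow> (real \<Rightarrow> real^2) \<Rightarrow> (real \<Rightarrow> complex) \<Rightarrow> real \<Rightarrow> complex" where
  "S' k L \<gamma> \<sigma> t = pv_integral L \<gamma> t (S'_integrand k \<gamma> \<sigma> t)"


section \<open>The kernels of the shape derivative\<close>

definition U1 ::
    "real \<Rightarrow> (real \<Rightarrow> real^2) \<Rightarrow> (real \<Rightarrow> real^2) \<Rightarrow> real \<Rightarrow> real \<Rightarrow> complex" where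
  "U1 k \<gamma> V t s = dotc (rot (tangential_deriv \<gamma> V t)) (grad_G k (\<gamma> t) (\<gamma> s))"

definition U2 ::
    "real \<Rightarrow> (real \<Rightarrow> real^2) \<Rightarrow> (real \<Rightarrow> real^2) \<Rightarrow> real \<Rightarrow> real \<Rightarrow> complex" where
  "U2 k \<gamma> V t s = dotc (unit_normal \<gamma> t) (hess_G k (\<gamma> t) (\<gamma> s) *v cvec (V t - V s))"

definition U3 ::
    "real \<Rightarrow> (real \<Rightarrow> real^2) \<Rightarrow> (real \<Rightarrow> real^2) \<Rightarrow> real \<Rightarrow> real \<Rightarrow> complex" where
  "U3 k \<gamma> V t s =
     dotc (unit_normal \<gamma> t) (grad_G k (\<gamma> t) (\<gamma> s)) *
     complex_of_real (unit_tangent \<gamma> s \<bullet> tangential_deriv \<gamma> V s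
                      - unit_tangent \<gamma> t \<bullet> tangential_deriv \<gamma> V t)"

end

theory Submission
  imports Defs
begin

text \<open>On the diagonal the kernel of \<open>S'\<close> is bounded, since the normal component of a chord of length
  \<open>O(h)\<close> is \<open>O(h\<^sup>2)\<close>. The same happens to the \<open>\<epsilon>\<close>-derivative of the kernel, uniformly in small \<open>\<epsilon>\<close>:
  \<open>n\<^sub>\<epsilon>(t)\<close> is orthogonal to the tangent at \<open>t\<close> for all \<open>\<epsilon>\<close>, so in the derivative of \<open>n\<^sub>\<epsilon>(t) \<bullet> (chord)\<close>
  the first-order terms cancel too, and they do so in \<open>U\<^sub>1 + U\<^sub>2\<close> although \<open>U\<^sub>1\<close> and \<open>U\<^sub>2\<close> are each of order
  \<open>1 / h\<close>. Hence the principal value is an ordinary integral and one may differentiate under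
  the integral sign by dominated convergence. Measuring \<open>h\<close> modulo the period treats both ends of
  the parameter interval as well.\<close>

section \<open>The fundamental solution as a radial function\<close>

text \<open>The perturbation is affine: the tangent at the target, the chord and the tangent at the
  source all have the form \<open>x + \<epsilon> *\<^sub>R y\<close>. Once the kernel is a function
  of these three vectors, its derivative has the same form at every small \<open>\<epsilon>\<close>,
  so one estimate for abstract vectors yields a dominating constant valid for all of them. The
  orders in \<open>h\<close> balance as follows. The first two derivatives of the radial profile in
  the squared distance are bounded by \<open>M / \<rho>\<close> and
  \<open>M / \<rho>\<^sup>2\<close>, that is by multiples of \<open>1 / h^2\<close> and
  \<open>1 / h^4\<close>, because chords have length at least \<open>c * \<bar>h\<bar>\<close>. The
  first is met by factors of order \<open>h^2\<close>. The second is multiplied by the normal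
  component of the chord and by the inner product of the chord with the difference of
  \<open>V\<close>, each of order \<open>h^2\<close>. The lower bound on chords rests on regularity
  and simplicity of the curve, and survives the perturbation because increments of \<open>V\<close>
  are also of order \<open>h\<close>. The target \<open>t\<close> is fixed, so constants may depend
  on it.\<close>

lemma everywhere_convergent_powser_derivs:
  fixes c :: "nat \<Rightarrow> real"
  assumes c: "\<And>x. summable (\<lambda>n. c n * x ^ n)"
  obtains f1 f2 where
    "\<And>x. ((\<lambda>x. \<Sum>n. c n * x ^ n) has_real_derivative f1 x) (at x)"
    "\<And>x. (f1 has_real_derivative f2 x) (at x)"
    "continuous_on UNIV f2"
proof -
  have c1: "summable (\<lambda>n. diffs c n * x ^ n)" for x
    by (rule termdiff_converges_all[OF c])
  have c2: "summable (\<lambda>n. diffs (diffs c) n * x ^ n)" for x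
    by (rule termdiff_converges_all[OF c1])
  show ?thesis
  proof
    show "((\<lambda>x. \<Sum>n. c n * x ^ n) has_real_derivative (\<Sum>n. diffs c n * x ^ n)) (at x)" for x
      by (rule termdiffs_strong_converges_everywhere[OF c])
    show "((\<lambda>x. \<Sum>n. diffs c n * x ^ n) has_real_derivative (\<Sum>n. diffs (diffs c) n * x ^ n)) (at x)" for x
      by (rule termdiffs_strong_converges_everywhere[OF c1])
    show "continuous_on UNIV (\<lambda>x. \<Sum>n. diffs (diffs c) n * x ^ n)"
      using termdiffs_strong_converges_everywhere[OF c2]
      by (meson DERIV_isCont continuous_at_imp_continuous_on)
  qed
qed

text \<open>A crude bound that is enough for the series of \<open>bessel_Y0\<close>: one of the two
  factorials in the denominator absorbs the harmonic number, and the other leaves an exponential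
  series. The induction step needs \<open>2 \<le> Suc n\<close>, hence the separate case
  \<open>n = 0\<close>.\<close>

lemma harm_le_fact: "harm n \<le> (fact n :: real)"
proof (induction n)
  case (Suc n)
  show ?case
  proof (cases n)
    case (Suc m)
    have "harm (Suc n) \<le> fact n + (1::real)"
      proof -
      have "inverse (real (Suc n)) \<le> 1" by (simp add: field_simps)
      then show ?thesis using Suc.IH unfolding harm_Suc by simp
    qed
    also have "\<dots> \<le> 2 * fact n"
      using fact_ge_1[of n, where 'a=real] by linarith
    also have "\<dots> \<le> real (Suc n) * fact n"
      using Suc by (intro mult_right_mono) auto
    finally show ?thesis by simp
  qed (simp add: harm_def)
qed (simp add: harm_def)

text \<open>Combines \<open>ln \<rho> \<le> \<rho>\<close> with the same inequality at
  \<open>1 / \<rho>\<close>. It makes the logarithmic terms harmless beside the poles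
  \<open>1 / \<rho>\<close> and \<open>1 / \<rho>\<^sup>2\<close>.\<close>

lemma abs_mult_ln_le:
  assumes "0 < (\<rho>::real)"
  shows "\<rho> * \<bar>ln \<rho>\<bar> \<le> 1 + \<rho>\<^sup>2"
proof -
  have 1: "ln \<rho> \<le> \<rho>" using ln_le_minus_one[OF assms] by simp
  have "ln (1 / \<rho>) \<le> 1 / \<rho> - 1" using assms by (intro ln_le_minus_one) simp
  then have 2: "- ln \<rho> \<le> 1 / \<rho>" using assms by (simp add: ln_div)
  have "\<bar>ln \<rho>\<bar> \<le> \<rho> + 1 / \<rho>" using 1 2 assms by (smt (verit) divide_pos_pos)
  then have "\<rho> * \<bar>ln \<rho>\<bar> \<le> \<rho> * (\<rho> + 1 / \<rho>)" using assms by (intro mult_left_mono) auto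
  also have "\<dots> = 1 + \<rho>\<^sup>2" using assms by (simp add: algebra_simps power2_eq_square)
  finally show ?thesis .
qed

lemma bounded_on_interval:
  fixes f :: "real \<Rightarrow> 'a::real_normed_vector"
  assumes "continuous_on {a..b} f"
  obtains B where "B \<ge> 0" "\<And>x. x \<in> {a..b} \<Longrightarrow> norm (f x) \<le> B"
proof -
  have "bounded (f ` {a..b})"
    using assms by (intro compact_imp_bounded compact_continuous_image) auto
  then obtain B where "B > 0" "\<forall>y\<in>f ` {a..b}. norm y \<le> B"
    using bounded_pos by blast
  then show ?thesis using that[of B] by auto
qed

text \<open>In the variable \<open>\<rho> = |x - y|\<^sup>2\<close> the fundamental solution is \<open>P \<rho> + ln \<rho> * Q \<rho>\<close>
  with entire \<open>P\<close> and \<open>Q\<close>; the singularities of its derivatives come from the logarithm.\<close>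

lemma helmholtz_G_radial:
  assumes k: "k > 0"
  obtains E F F' :: "real \<Rightarrow> complex" where
    "\<And>x y. x \<noteq> y \<Longrightarrow> helmholtz_G k x y = E ((norm (x - y))\<^sup>2)"
    "\<And>\<rho>. \<rho> > 0 \<Longrightarrow> (E has_vector_derivative F \<rho>) (at \<rho>)"
    "\<And>\<rho>. \<rho> > 0 \<Longrightarrow> (F has_vector_derivative F' \<rho>) (at \<rho>)"
    "\<And>R. \<exists>M\<ge>0. \<forall>\<rho>\<in>{0<..R}. norm (F \<rho>) \<le> M / \<rho> \<and> norm (F' \<rho>) \<le> M / \<rho>\<^sup>2"
proof -
  \<comment> \<open>Coefficients of the two Bessel series in the variable
    \<open>\<rho> = r^2\<close>, since \<open>(k * r / 2) ^ (2 * m)\<close> equals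
    \<open>(k^2 / 4) ^ m * \<rho> ^ m\<close>.\<close>
  define ca :: "nat \<Rightarrow> real" where "ca m = (-1) ^ m * (k\<^sup>2 / 4) ^ m / (fact m)\<^sup>2" for m
  define cb :: "nat \<Rightarrow> real" where "cb m = (-1) ^ m * harm m * (k\<^sup>2 / 4) ^ m / (fact m)\<^sup>2" for m
  define a where "a = (\<lambda>x. \<Sum>n. ca n * x ^ n)"
  define b where "b = (\<lambda>x. \<Sum>n. cb n * x ^ n)"
  have exps: "summable (\<lambda>n. (k\<^sup>2 / 4 * \<bar>x\<bar>) ^ n / fact n)" for x :: real
    using summable_exp[of "k\<^sup>2 / 4 * \<bar>x\<bar>"] by (simp only: divide_inverse_commute)
  have le: "\<bar>cb n * x ^ n\<bar> \<le> (k\<^sup>2 / 4 * \<bar>x\<bar>) ^ n / fact n"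
       "\<bar>ca n * x ^ n\<bar> \<le> (k\<^sup>2 / 4 * \<bar>x\<bar>) ^ n / fact n" for n x
  proof -
    \<comment> \<open>Both series are compared with an exponential series at once:
      \<open>u = harm n\<close> gives \<open>cb\<close>, and \<open>u = 1\<close> gives
      \<open>ca\<close>.\<close>
    have *: "\<bar>(-1) ^ n * u * (k\<^sup>2 / 4) ^ n / (fact n)\<^sup>2 * x ^ n\<bar> \<le> (k\<^sup>2 / 4 * \<bar>x\<bar>) ^ n / fact n"
      if u: "0 \<le> u" "u \<le> fact n" for u :: real
    proof -
      have "\<bar>(-1) ^ n * u * (k\<^sup>2 / 4) ^ n / (fact n)\<^sup>2 * x ^ n\<bar> = (k\<^sup>2 / 4 * \<bar>x\<bar>) ^ n * (u / (fact n)\<^sup>2)"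
        using u by (simp add: abs_mult power_abs power_mult_distrib power_divide)
      also have "\<dots> \<le> (k\<^sup>2 / 4 * \<bar>x\<bar>) ^ n * (1 / fact n)"
        using u by (intro mult_left_mono) (auto simp: divide_simps power2_eq_square)
      finally show ?thesis by simp
    qed
    show "\<bar>cb n * x ^ n\<bar> \<le> (k\<^sup>2 / 4 * \<bar>x\<bar>) ^ n / fact n"
      unfolding cb_def by (rule *) (auto simp: harm_nonneg harm_le_fact)
    show "\<bar>ca n * x ^ n\<bar> \<le> (k\<^sup>2 / 4 * \<bar>x\<bar>) ^ n / fact n"
      using *[of 1] by (simp add: ca_def fact_ge_1)
  qed
  have ca: "summable (\<lambda>n. ca n * x ^ n)" for x
    by (rule summable_comparison_test'[OF exps[of x], of 0]) (simp only: real_norm_def le)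
  have cb: "summable (\<lambda>n. cb n * x ^ n)" for x
    by (rule summable_comparison_test'[OF exps[of x], of 0]) (simp only: real_norm_def le)
  obtain a1 a2 where a1: "\<And>x. (a has_real_derivative a1 x) (at x)"
    and a2: "\<And>x. (a1 has_real_derivative a2 x) (at x)" and a2c: "continuous_on UNIV a2"
    by (rule everywhere_convergent_powser_derivs[OF ca, folded a_def]) (rule that)
  obtain b1 b2 where b1: "\<And>x. (b has_real_derivative b1 x) (at x)"
    and b2: "\<And>x. (b1 has_real_derivative b2 x) (at x)" and b2c: "continuous_on UNIV b2"
    by (rule everywhere_convergent_powser_derivs[OF cb, folded b_def]) (rule that)
  have cont: "continuous_on S f" if "\<And>x. (f has_real_derivative f' x) (at x)" for f f' S
    by (rule continuous_at_imp_continuous_on) (use that DERIV_isCont in blast)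
  note [continuous_intros] = cont[OF a1] cont[OF a2] cont[OF b1] cont[OF b2]
    continuous_on_subset[OF a2c subset_UNIV] continuous_on_subset[OF b2c subset_UNIV]
  \<comment> \<open>These constants come from expanding \<open>\<i> / 4 * (J + \<i> * Y)\<close>
    with \<open>ln (k * r / 2) = ln (k / 2) + ln \<rho> / 2\<close>. They collect the coefficients
    of \<open>a\<close>, of \<open>b\<close> and of \<open>ln \<rho> * a\<close>; the factor
    \<open>1 / 2\<close> before \<open>ln \<rho>\<close> turns \<open>2 * pi\<close> into
    \<open>4 * pi\<close> in \<open>\<kappa>\<close>.\<close>
  define \<alpha> where "\<alpha> = \<i> / 4 + complex_of_real (- (ln (k / 2) + euler_mascheroni) / (2 * pi))"
  define \<beta> where "\<beta> = complex_of_real (1 / (2 * pi))"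
  define \<kappa> where "\<kappa> = complex_of_real (- 1 / (4 * pi))"
  define E where "E \<rho> = of_real (a \<rho>) * \<alpha> + of_real (b \<rho>) * \<beta> + of_real (ln \<rho> * a \<rho>) * \<kappa>" for \<rho>
  define F where "F \<rho> = of_real (a1 \<rho>) * \<alpha> + of_real (b1 \<rho>) * \<beta>
      + of_real (a \<rho> / \<rho> + ln \<rho> * a1 \<rho>) * \<kappa>" for \<rho>
  define F' where "F' \<rho> = of_real (a2 \<rho>) * \<alpha> + of_real (b2 \<rho>) * \<beta>
      + of_real (2 * a1 \<rho> / \<rho> - a \<rho> / \<rho>\<^sup>2 + ln \<rho> * a2 \<rho>) * \<kappa>" for \<rho>
  note D = a1[THEN DERIV_chain2] a2[THEN DERIV_chain2] b1[THEN DERIV_chain2] b2[THEN DERIV_chain2]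
  have vd: "((\<lambda>x. complex_of_real (f x) * z) has_vector_derivative (of_real f' * z)) (at x)"
    if "(f has_real_derivative f') (at x)" for f f' x z
    by (intro has_vector_derivative_mult_left has_vector_derivative_of_real that)
  show ?thesis
  proof
    fix x y :: "real^2" assume "x \<noteq> y"
    define r where "r = norm (x - y)"
    have r: "r > 0" using \<open>x \<noteq> y\<close> by (simp add: r_def)
    have pw: "(k * r / 2) ^ (2 * m) = (k\<^sup>2 / 4) ^ m * (r\<^sup>2) ^ m" for m
      by (simp add: power_mult power_divide power_mult_distrib)
    have J: "bessel_J0 (k * r) = a (r\<^sup>2)"
      unfolding bessel_J0_def a_def ca_def pw by (simp add: mult_ac)
    have Y: "bessel_Y0 (k * r) = 2 / pi * (ln (k / 2) + ln (r\<^sup>2) / 2 + euler_mascheroni) * a (r\<^sup>2)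
              - 2 / pi * b (r\<^sup>2)"
    proof -
      have "(\<Sum>m. (-1) ^ m * harm m * (k * r / 2) ^ (2 * m) / (fact m)\<^sup>2) = b (r\<^sup>2)"
        unfolding b_def cb_def pw by (simp add: mult_ac)
      then show ?thesis
        unfolding bessel_Y0_def J using k r by (simp add: ln_mult ln_div ln_realpow)
    qed
    have eul: "Re euler_mascheroni = euler_mascheroni" "Im euler_mascheroni = 0"
      by (metis Re_complex_of_real of_real_euler_mascheroni, metis Im_complex_of_real of_real_euler_mascheroni)
    have "helmholtz_G k x y = E (r\<^sup>2)"
      unfolding helmholtz_G_def hankel1_0_def r_def[symmetric] J Y E_def \<alpha>_def \<beta>_def \<kappa>_def
      by (simp add: complex_eq_iff eul field_simps)
    then show "helmholtz_G k x y = E ((norm (x - y))\<^sup>2)" by (simp add: r_def)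
  next
    fix \<rho> :: real assume \<rho>: "\<rho> > 0"
    show "(E has_vector_derivative F \<rho>) (at \<rho>)"
      unfolding E_def[abs_def] F_def
      by (intro has_vector_derivative_add vd a1 b1)
         (use \<rho> in \<open>auto intro!: derivative_eq_intros D simp: field_simps\<close>)
    show "(F has_vector_derivative F' \<rho>) (at \<rho>)"
      unfolding F_def[abs_def] F'_def
      by (intro has_vector_derivative_add vd a2 b2)
         (use \<rho> in \<open>auto intro!: derivative_eq_intros D simp: field_simps power2_eq_square\<close>)
  next
    fix R :: real
    \<comment> \<open>Bounding the sum of the absolute values gives one constant for all five
      functions. The interval may include \<open>0\<close>, since the logarithm and the poles are
      kept out of these functions.\<close>
    have cont: "continuous_on {0..R} (\<lambda>\<rho>. \<bar>a \<rho>\<bar> + \<bar>a1 \<rho>\<bar> + \<bar>a2 \<rho>\<bar> + \<bar>b1 \<rho>\<bar> + \<bar>b2 \<rho>\<bar>)"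
      by (intro continuous_intros)
    obtain B where B: "B \<ge> 0" and
      all: "\<And>\<rho>. \<rho> \<in> {0..R} \<Longrightarrow> norm (\<bar>a \<rho>\<bar> + \<bar>a1 \<rho>\<bar> + \<bar>a2 \<rho>\<bar> + \<bar>b1 \<rho>\<bar> + \<bar>b2 \<rho>\<bar>) \<le> B"
      using bounded_on_interval[OF cont] by blast
    have bd: "\<bar>a \<rho>\<bar> \<le> B" "\<bar>a1 \<rho>\<bar> \<le> B" "\<bar>a2 \<rho>\<bar> \<le> B" "\<bar>b1 \<rho>\<bar> \<le> B" "\<bar>b2 \<rho>\<bar> \<le> B"
      if "\<rho> \<in> {0<..R}" for \<rho>
    proof -
      have *: "p \<le> B" "q \<le> B" "r \<le> B" "u \<le> B" "v \<le> B"
        if "norm (p + q + r + u + v) \<le> B" "0 \<le> p" "0 \<le> q" "0 \<le> r" "0 \<le> u" "0 \<le> v" for p q r u v :: real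
        using that by simp_all
      have "\<rho> \<in> {0..R}" using that by simp
      note * [OF all[OF this] abs_ge_zero abs_ge_zero abs_ge_zero abs_ge_zero abs_ge_zero]
      then show "\<bar>a \<rho>\<bar> \<le> B" "\<bar>a1 \<rho>\<bar> \<le> B" "\<bar>a2 \<rho>\<bar> \<le> B" "\<bar>b1 \<rho>\<bar> \<le> B" "\<bar>b2 \<rho>\<bar> \<le> B" .
    qed
    \<comment> \<open>Bounds for \<open>\<rho> * F \<rho>\<close> and
      \<open>\<rho>\<^sup>2 * F' \<rho>\<close>: multiplication clears the poles and leaves the
      logarithm only in the product \<open>\<rho> * ln \<rho>\<close>.\<close>
    define M1 where "M1 = R * B * norm \<alpha> + R * B * norm \<beta> + (B + (1 + R\<^sup>2) * B) * norm \<kappa>"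
    define M2 where "M2 = R\<^sup>2 * B * norm \<alpha> + R\<^sup>2 * B * norm \<beta> + (2 * R * B + B + R * (1 + R\<^sup>2) * B) * norm \<kappa>"
    have "norm (F \<rho>) \<le> M1 / \<rho>" "norm (F' \<rho>) \<le> M2 / \<rho>\<^sup>2" if \<rho>: "\<rho> \<in> {0<..R}" for \<rho>
    proof -
      have pos: "\<rho> > 0" and R: "\<rho> \<le> R" "R \<ge> 0" using \<rho> by auto
      have \<rho>2: "\<rho>\<^sup>2 \<le> R\<^sup>2" using pos R by (intro power_mono) auto
      have l: "\<rho> * \<bar>ln \<rho>\<bar> \<le> 1 + R\<^sup>2" using abs_mult_ln_le[OF pos] \<rho>2 by linarith
      have l2: "\<rho> * (\<rho> * \<bar>ln \<rho>\<bar>) \<le> R * (1 + R\<^sup>2)"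
        using l pos R by (intro mult_mono) auto
      have "\<rho> * norm (F \<rho>) = norm (of_real \<rho> * F \<rho>)"
        using pos by (simp add: norm_mult)
      also have "of_real \<rho> * F \<rho> = of_real (\<rho> * a1 \<rho>) * \<alpha> + of_real (\<rho> * b1 \<rho>) * \<beta>
          + of_real (a \<rho> + \<rho> * ln \<rho> * a1 \<rho>) * \<kappa>"
        using pos by (simp add: F_def field_simps)
      also have "norm \<dots> \<le> \<bar>\<rho> * a1 \<rho>\<bar> * norm \<alpha> + \<bar>\<rho> * b1 \<rho>\<bar> * norm \<beta>
          + \<bar>a \<rho> + \<rho> * ln \<rho> * a1 \<rho>\<bar> * norm \<kappa>"
        by (intro norm_triangle_le add_mono) (simp_all only: norm_mult norm_of_real order_refl)
      also have "\<dots> \<le> M1"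
      proof -
        have "\<bar>\<rho> * a1 \<rho>\<bar> \<le> R * B" "\<bar>\<rho> * b1 \<rho>\<bar> \<le> R * B"
          using pos R bd[OF \<rho>] B by (auto simp: abs_mult intro!: mult_mono)
        moreover have "\<bar>\<rho> * ln \<rho> * a1 \<rho>\<bar> \<le> (1 + R\<^sup>2) * B"
          using pos l bd[OF \<rho>] B by (auto simp: abs_mult intro!: mult_mono)
        then have "\<bar>a \<rho> + \<rho> * ln \<rho> * a1 \<rho>\<bar> \<le> B + (1 + R\<^sup>2) * B"
          using bd(1)[OF \<rho>] by linarith
        ultimately show ?thesis unfolding M1_def by (intro add_mono mult_right_mono) auto
      qed
      finally show "norm (F \<rho>) \<le> M1 / \<rho>" using pos by (simp add: field_simps)
      have "\<rho>\<^sup>2 * norm (F' \<rho>) = norm (of_real (\<rho>\<^sup>2) * F' \<rho>)"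
        by (simp add: norm_mult norm_power)
      also have "of_real (\<rho>\<^sup>2) * F' \<rho> = of_real (\<rho>\<^sup>2 * a2 \<rho>) * \<alpha> + of_real (\<rho>\<^sup>2 * b2 \<rho>) * \<beta>
          + of_real (2 * \<rho> * a1 \<rho> - a \<rho> + \<rho> * (\<rho> * ln \<rho>) * a2 \<rho>) * \<kappa>"
        using pos by (simp add: F'_def field_simps power2_eq_square)
      also have "norm \<dots> \<le> \<bar>\<rho>\<^sup>2 * a2 \<rho>\<bar> * norm \<alpha> + \<bar>\<rho>\<^sup>2 * b2 \<rho>\<bar> * norm \<beta>
          + \<bar>2 * \<rho> * a1 \<rho> - a \<rho> + \<rho> * (\<rho> * ln \<rho>) * a2 \<rho>\<bar> * norm \<kappa>"
        by (intro norm_triangle_le add_mono) (simp_all only: norm_mult norm_of_real order_refl)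
      also have "\<dots> \<le> M2"
      proof -
        have "\<bar>\<rho>\<^sup>2 * a2 \<rho>\<bar> \<le> R\<^sup>2 * B" "\<bar>\<rho>\<^sup>2 * b2 \<rho>\<bar> \<le> R\<^sup>2 * B"
          using \<rho>2 bd[OF \<rho>] B by (auto simp: abs_mult intro!: mult_mono)
        moreover have "\<bar>2 * \<rho> * a1 \<rho>\<bar> \<le> 2 * R * B"
          using pos R bd[OF \<rho>] B by (auto simp: abs_mult intro!: mult_mono)
        moreover have "\<bar>\<rho> * (\<rho> * ln \<rho>) * a2 \<rho>\<bar> \<le> R * (1 + R\<^sup>2) * B"
        proof -
          have "\<bar>\<rho> * (\<rho> * ln \<rho>)\<bar> \<le> R * (1 + R\<^sup>2)" using l2 pos by (simp add: abs_mult)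
          then show ?thesis
            unfolding abs_mult[of "\<rho> * (\<rho> * ln \<rho>)"] using R bd[OF \<rho>] by (intro mult_mono) auto
        qed
        ultimately have "\<bar>2 * \<rho> * a1 \<rho> - a \<rho> + \<rho> * (\<rho> * ln \<rho>) * a2 \<rho>\<bar>
            \<le> 2 * R * B + B + R * (1 + R\<^sup>2) * B"
          using bd(1)[OF \<rho>] by linarith
        with \<open>\<bar>\<rho>\<^sup>2 * a2 \<rho>\<bar> \<le> R\<^sup>2 * B\<close> \<open>\<bar>\<rho>\<^sup>2 * b2 \<rho>\<bar> \<le> R\<^sup>2 * B\<close>
        show ?thesis unfolding M2_def by (intro add_mono mult_right_mono) auto
      qed
      finally show "norm (F' \<rho>) \<le> M2 / \<rho>\<^sup>2" using pos by (simp add: field_simps)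
    qed
    then show "\<exists>M\<ge>0. \<forall>\<rho>\<in>{0<..R}. norm (F \<rho>) \<le> M / \<rho> \<and> norm (F' \<rho>) \<le> M / \<rho>\<^sup>2"
      by (intro exI[of _ "\<bar>M1\<bar> + \<bar>M2\<bar>"])
         (force intro: order_trans[OF _ divide_right_mono])
  qed
qed

section \<open>Gradient and Hessian of a radial function\<close>

lemma has_derivative_radial:
  fixes F :: "real \<Rightarrow> 'b::real_normed_vector" and x y :: "'a::real_inner"
  assumes "(F has_vector_derivative F') (at ((norm (x - y))\<^sup>2))"
  shows "((\<lambda>z. F ((norm (z - y))\<^sup>2)) has_derivative (\<lambda>h. (2 * (h \<bullet> (x - y))) *\<^sub>R F')) (at x)"
proof -
  have "((\<lambda>z. (norm (z - y))\<^sup>2) has_derivative (\<lambda>h. 2 * (h \<bullet> (x - y)))) (at x)"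
    unfolding power2_norm_eq_inner
    by (auto intro!: derivative_eq_intros simp: inner_commute algebra_simps)
  from has_derivative_compose[OF this assms[unfolded has_vector_derivative_def]]
  show ?thesis .
qed

lemma gradient_eq:
  assumes "(f has_derivative f') (at x)"
  shows "gradient f x = (\<chi> i. f' (axis i 1))"
  unfolding gradient_def using frechet_derivative_at[OF assms] by simp

text \<open>At the source \<open>y\<close> the fundamental solution has no meaningful value, so the
  radial form is assumed only off \<open>y\<close>. The derivative is carried over on the open set
  \<open>- {y}\<close>. In the squared distance the chain rule produces no factor
  \<open>1 / norm (x - y)\<close>.\<close>

lemma gradient_radial:
  fixes f :: "real^'n \<Rightarrow> complex"
  assumes f: "\<And>z. z \<noteq> y \<Longrightarrow> f z = E ((norm (z - y))\<^sup>2)"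
    and E: "\<And>\<rho>. \<rho> > 0 \<Longrightarrow> (E has_vector_derivative F \<rho>) (at \<rho>)"
    and "x \<noteq> y"
  shows "gradient f x = (\<chi> i. of_real (2 * (x - y) $ i) * F ((norm (x - y))\<^sup>2))"
proof -
  have "((\<lambda>z. E ((norm (z - y))\<^sup>2)) has_derivative
      (\<lambda>h. (2 * (h \<bullet> (x - y))) *\<^sub>R F ((norm (x - y))\<^sup>2))) (at x)"
    using \<open>x \<noteq> y\<close> by (intro has_derivative_radial E) simp
  then have "(f has_derivative (\<lambda>h. (2 * (h \<bullet> (x - y))) *\<^sub>R F ((norm (x - y))\<^sup>2))) (at x)"
    by (rule has_derivative_transform_within_open[of _ _ _ _ "- {y}"]) (use f \<open>x \<noteq> y\<close> in auto)
  from gradient_eq[OF this] show ?thesis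
    by (simp add: inner_axis' scaleR_conv_of_real)
qed

text \<open>The gradient formula holds on the whole open set \<open>- {y}\<close>, so it may be
  differentiated again by the product rule: the linear factor gives the multiple of the identity,
  and \<open>F\<close> gives the rank-one part.\<close>

lemma hessian_radial:
  fixes f :: "real^'n \<Rightarrow> complex"
  assumes f: "\<And>z. z \<noteq> y \<Longrightarrow> f z = E ((norm (z - y))\<^sup>2)"
    and E: "\<And>\<rho>. \<rho> > 0 \<Longrightarrow> (E has_vector_derivative F \<rho>) (at \<rho>)"
    and F: "\<And>\<rho>. \<rho> > 0 \<Longrightarrow> (F has_vector_derivative F' \<rho>) (at \<rho>)"
    and "x \<noteq> y"
  shows "hessian f x = (\<chi> i j. of_real (if i = j then 2 else 0) * F ((norm (x - y))\<^sup>2)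
           + of_real (4 * (x - y) $ i * (x - y) $ j) * F' ((norm (x - y))\<^sup>2))"
proof -
  have "gradient (\<lambda>z. gradient f z $ j) x $ i =
      of_real (if i = j then 2 else 0) * F ((norm (x - y))\<^sup>2)
      + of_real (4 * (x - y) $ i * (x - y) $ j) * F' ((norm (x - y))\<^sup>2)" for i j
  proof -
    have axis_ij: "axis i (1::real) $ j = (if i = j then 1 else 0)"
      by (simp add: axis_def)
    have *: "((\<lambda>z. F ((norm (z - y))\<^sup>2)) has_derivative
      (\<lambda>h. (2 * (h \<bullet> (x - y))) *\<^sub>R F' ((norm (x - y))\<^sup>2))) (at x)"
      using \<open>x \<noteq> y\<close> by (intro has_derivative_radial F) simp
    have "((\<lambda>z. (2 * (z - y) $ j) *\<^sub>R F ((norm (z - y))\<^sup>2)) has_derivative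
      (\<lambda>h. (2 * (x - y) $ j) *\<^sub>R (2 * (h \<bullet> (x - y))) *\<^sub>R F' ((norm (x - y))\<^sup>2)
          + (2 * h $ j) *\<^sub>R F ((norm (x - y))\<^sup>2))) (at x)"
      by (intro has_derivative_scaleR * ) (auto intro!: derivative_eq_intros
          bounded_linear_imp_has_derivative bounded_linear_vec_nth simp: algebra_simps)
    then have "((\<lambda>z. gradient f z $ j) has_derivative
      (\<lambda>h. (2 * (x - y) $ j) *\<^sub>R (2 * (h \<bullet> (x - y))) *\<^sub>R F' ((norm (x - y))\<^sup>2)
          + (2 * h $ j) *\<^sub>R F ((norm (x - y))\<^sup>2))) (at x)"
      by (rule has_derivative_transform_within_open[of _ _ _ _ "- {y}"])
         (use \<open>x \<noteq> y\<close> in \<open>auto simp: gradient_radial[OF f E] scaleR_conv_of_real\<close>)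
    from gradient_eq[OF this] show ?thesis using axis_ij
      by (simp add: inner_axis' scaleR_conv_of_real algebra_simps)
  qed
  then show ?thesis by (simp add: hessian_def vec_eq_iff)
qed

section \<open>The kernel and its variation\<close>

lemma rot_nth [simp]: "rot v $ 1 = v $ 2" "rot v $ 2 = - v $ 1"
  by (simp_all add: rot_def vector_2)

lemma inner_vec2: "x \<bullet> y = x $ 1 * y $ 1 + x $ 2 * (y::real^2) $ 2"
  by (simp add: inner_vec_def sum_2)

lemma rot_linear: "rot (x + y) = rot x + rot y" "rot (r *\<^sub>R x) = r *\<^sub>R rot x"
  by (simp_all add: vec_eq_iff forall_2)

lemma rot_inner_self [simp]: "rot v \<bullet> v = 0"
  by (simp add: inner_vec2)

lemma norm_rot [simp]: "norm (rot v) = norm v"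
  by (simp add: norm_eq_sqrt_inner inner_vec2 add.commute)

lemma dotc_radial_gradient:
  fixes n d :: "real^2"
  shows "dotc n (\<chi> i. of_real (2 * d $ i) * z) = of_real (2 * (n \<bullet> d)) * z"
  by (simp add: dotc_def sum_2 inner_vec2 algebra_simps)

lemma dotc_radial_hessian:
  fixes n d w :: "real^2"
  shows "dotc n ((\<chi> i j. of_real (if i = j then 2 else 0) * z
           + of_real (4 * d $ i * d $ j) * z') *v cvec w)
         = of_real (2 * (n \<bullet> w)) * z + of_real (4 * (n \<bullet> d) * (d \<bullet> w)) * z'"
  by (simp add: dotc_def sum_2 inner_vec2 matrix_vector_mult_def cvec_def algebra_simps)

text \<open>The integrand of \<open>S'\<close> (without the density) in terms of \<open>F\<close>, the tangent vector \<open>v\<close> at the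
  target, the chord \<open>d\<close> from source to target and the tangent vector \<open>u\<close> at the source, followed by
  its derivative in the direction \<open>(w, W, w')\<close> of a variation of \<open>(v, d, u)\<close>.\<close>

definition kern :: "(real \<Rightarrow> complex) \<Rightarrow> real^2 \<Rightarrow> real^2 \<Rightarrow> real^2 \<Rightarrow> complex" where
  "kern F v d u = of_real (2 * (rot v \<bullet> d / norm v) * norm u) * F ((norm d)\<^sup>2)"

definition dkern :: "(real \<Rightarrow> complex) \<Rightarrow> (real \<Rightarrow> complex) \<Rightarrow> real^2 \<Rightarrow> real^2 \<Rightarrow> real^2 \<Rightarrow>
    real^2 \<Rightarrow> real^2 \<Rightarrow> real^2 \<Rightarrow> complex" where
  "dkern F F' v d u w W w' =
     of_real (2 * ((rot w \<bullet> d + rot v \<bullet> W) / norm v - (rot v \<bullet> d) * (v \<bullet> w) / norm v ^ 3) * norm u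
            + 2 * (rot v \<bullet> d / norm v) * (u \<bullet> w' / norm u)) * F ((norm d)\<^sup>2)
     + of_real (4 * (rot v \<bullet> d / norm v) * norm u * (d \<bullet> W)) * F' ((norm d)\<^sup>2)"

lemma has_real_derivative_norm_affine:
  fixes u w :: "'a::real_inner"
  assumes "u + x *\<^sub>R w \<noteq> 0"
  shows "((\<lambda>x. norm (u + x *\<^sub>R w)) has_real_derivative ((u + x *\<^sub>R w) \<bullet> w / norm (u + x *\<^sub>R w))) (at x)"
proof -
  have "((\<lambda>x. u + x *\<^sub>R w) has_derivative (\<lambda>h. h *\<^sub>R w)) (at x)"
    by (auto intro!: derivative_eq_intros)
  from has_derivative_compose[OF this has_derivative_norm[OF assms]]
  show ?thesis
    unfolding has_field_derivative_def
    by (rule has_derivative_eq_rhs)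
       (auto simp: fun_eq_iff sgn_div_norm inner_commute divide_inverse mult_ac)
qed

text \<open>Stated at an arbitrary \<open>x\<close> and not only at \<open>0\<close>: bounding
  difference quotients requires the derivative at all intermediate parameters.\<close>

lemma has_vector_derivative_kern:
  assumes F: "\<And>\<rho>. \<rho> > 0 \<Longrightarrow> (F has_vector_derivative F' \<rho>) (at \<rho>)"
    and nz: "v + x *\<^sub>R w \<noteq> 0" "d + x *\<^sub>R W \<noteq> 0" "u + x *\<^sub>R w' \<noteq> 0"
  shows "((\<lambda>x. kern F (v + x *\<^sub>R w) (d + x *\<^sub>R W) (u + x *\<^sub>R w')) has_vector_derivative
          dkern F F' (v + x *\<^sub>R w) (d + x *\<^sub>R W) (u + x *\<^sub>R w') w W w') (at x)"
proof -
  have rotd: "((\<lambda>x. rot (v + x *\<^sub>R w) \<bullet> (d + x *\<^sub>R W)) has_real_derivative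
      (rot w \<bullet> (d + x *\<^sub>R W) + rot (v + x *\<^sub>R w) \<bullet> W)) (at x)"
    unfolding inner_vec2 by (auto intro!: derivative_eq_intros simp: algebra_simps)
  have nn: "norm (v + x *\<^sub>R w) \<noteq> 0" using nz by simp
  have a: "((\<lambda>x. rot (v + x *\<^sub>R w) \<bullet> (d + x *\<^sub>R W) / norm (v + x *\<^sub>R w)) has_real_derivative
      ((rot w \<bullet> (d + x *\<^sub>R W) + rot (v + x *\<^sub>R w) \<bullet> W) / norm (v + x *\<^sub>R w)
       - (rot (v + x *\<^sub>R w) \<bullet> (d + x *\<^sub>R W)) * ((v + x *\<^sub>R w) \<bullet> w) / norm (v + x *\<^sub>R w) ^ 3)) (at x)"
    using nn by (intro DERIV_cong[OF DERIV_divide[OF rotd has_real_derivative_norm_affine[OF nz(1)] nn]])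
      (simp add: field_simps power2_eq_square power3_eq_cube)
  have ab: "((\<lambda>x. 2 * (rot (v + x *\<^sub>R w) \<bullet> (d + x *\<^sub>R W) / norm (v + x *\<^sub>R w)) * norm (u + x *\<^sub>R w'))
     has_real_derivative 2 * ((rot w \<bullet> (d + x *\<^sub>R W) + rot (v + x *\<^sub>R w) \<bullet> W) / norm (v + x *\<^sub>R w)
       - (rot (v + x *\<^sub>R w) \<bullet> (d + x *\<^sub>R W)) * ((v + x *\<^sub>R w) \<bullet> w) / norm (v + x *\<^sub>R w) ^ 3) * norm (u + x *\<^sub>R w')
       + 2 * (rot (v + x *\<^sub>R w) \<bullet> (d + x *\<^sub>R W) / norm (v + x *\<^sub>R w))
         * ((u + x *\<^sub>R w') \<bullet> w' / norm (u + x *\<^sub>R w'))) (at x)"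
    by (rule DERIV_cong[OF DERIV_mult[OF DERIV_cmult[OF a] has_real_derivative_norm_affine[OF nz(3)]]])
       (simp add: mult_ac)
  have \<rho>: "((\<lambda>x. (norm (d + x *\<^sub>R W))\<^sup>2) has_vector_derivative 2 * ((d + x *\<^sub>R W) \<bullet> W)) (at x)"
    unfolding has_real_derivative_iff_has_vector_derivative[symmetric]
    by (rule DERIV_cong[OF DERIV_power[OF has_real_derivative_norm_affine[OF nz(2)]]]) (use nz in simp)
  have "((\<lambda>x. F ((norm (d + x *\<^sub>R W))\<^sup>2)) has_vector_derivative
      (2 * ((d + x *\<^sub>R W) \<bullet> W)) *\<^sub>R F' ((norm (d + x *\<^sub>R W))\<^sup>2)) (at x)"
    using vector_diff_chain_at[OF \<rho> F] nz by (simp add: o_def)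
  from has_vector_derivative_mult[OF
      has_vector_derivative_of_real[OF ab] this]
  show ?thesis
    unfolding kern_def dkern_def
    by (rule has_vector_derivative_eq_rhs) (simp add: scaleR_conv_of_real mult_ac add.commute)
qed

text \<open>Here \<open>h\<close> is the parameter increment from target to source, so the chord
  \<open>d\<close> from source to target is close to \<open>- h *\<^sub>R v\<close>; this explains
  the sum \<open>d + h *\<^sub>R v\<close>. As \<open>rot v\<close> is orthogonal to
  \<open>v\<close>, only this remainder contributes to \<open>rot v \<bullet> d\<close>, and its
  factor \<open>h^2\<close> cancels the one in the bound for \<open>F\<close>.\<close>

lemma norm_kern_le:
  assumes c: "c > 0" and h: "h \<noteq> 0"
    and v: "norm v \<ge> c" and u: "norm u \<le> B"
    and dv: "norm (d + h *\<^sub>R v) \<le> B * h\<^sup>2" and d: "c * \<bar>h\<bar> \<le> norm d"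
    and F: "norm (F ((norm d)\<^sup>2)) \<le> M / (norm d)\<^sup>2" and M: "M \<ge> 0"
  shows "norm (kern F v d u) \<le> 2 * B\<^sup>2 * M / c\<^sup>2"
proof -
  have B: "0 \<le> B" using u norm_ge_zero order_trans by blast
  have v0: "norm v > 0" using v c by linarith
  have "rot v \<bullet> d = rot v \<bullet> (d + h *\<^sub>R v)" by (simp add: inner_add_right)
  then have "\<bar>rot v \<bullet> d\<bar> \<le> norm v * (B * h\<^sup>2)"
    using Cauchy_Schwarz_ineq2[of "rot v" "d + h *\<^sub>R v"] mult_left_mono[OF dv norm_ge_zero[of v]] by simp
  then have a: "\<bar>rot v \<bullet> d / norm v\<bar> \<le> B * h\<^sup>2"
    using v0 by (simp add: pos_divide_le_eq mult_ac)
  have d2: "c\<^sup>2 * h\<^sup>2 \<le> (norm d)\<^sup>2" using power_mono[OF d, of 2] c by (simp add: power_mult_distrib)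
  have F2: "norm (F ((norm d)\<^sup>2)) \<le> M / (c\<^sup>2 * h\<^sup>2)"
    using F by (rule order_trans) (use d2 c h M in \<open>auto intro!: frac_le\<close>)
  have "norm (kern F v d u) = 2 * \<bar>rot v \<bullet> d / norm v\<bar> * norm u * norm (F ((norm d)\<^sup>2))"
    unfolding kern_def norm_mult norm_of_real by (simp add: abs_mult)
  also have "\<dots> \<le> 2 * (B * h\<^sup>2) * B * (M / (c\<^sup>2 * h\<^sup>2))"
    using a u F2 B by (intro mult_mono) auto
  also have "\<dots> = 2 * B\<^sup>2 * M / c\<^sup>2"
    using h by (simp add: field_simps power2_eq_square)
  finally show ?thesis .
qed

text \<open>The first-order terms in \<open>h\<close> cancel because \<open>rot\<close> is skew-symmetric; this is the
  derivative of the orthogonality of the normal and the tangent.\<close>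

lemma norm_dkern_le:
  assumes c: "c > 0" and h: "h \<noteq> 0"
    and v: "norm v \<ge> c" "norm v \<le> B" and u: "norm u \<ge> c" "norm u \<le> B"
    and w: "norm w \<le> B" "norm w' \<le> B"
    and dv: "norm (d + h *\<^sub>R v) \<le> B * h\<^sup>2" and Ww: "norm (W + h *\<^sub>R w) \<le> B * h\<^sup>2"
    and d: "c * \<bar>h\<bar> \<le> norm d" "norm d \<le> B * \<bar>h\<bar>" and W: "norm W \<le> B * \<bar>h\<bar>"
    and F: "norm (F ((norm d)\<^sup>2)) \<le> M / (norm d)\<^sup>2"
    and F': "norm (F' ((norm d)\<^sup>2)) \<le> M / ((norm d)\<^sup>2)\<^sup>2" and M: "M \<ge> 0"
  shows "norm (dkern F F' v d u w W w') \<le> (6 * B ^ 3 / c + 2 * B\<^sup>2) * M / c\<^sup>2 + 4 * B ^ 4 * M / c ^ 4"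
proof -
  have B: "0 \<le> B" using u norm_ge_zero order_trans by blast
  have v0: "norm v > 0" and u0: "norm u > 0" using v u c by linarith+
  have h2: "h\<^sup>2 > 0" using h by simp
  have "rot v \<bullet> d = rot v \<bullet> (d + h *\<^sub>R v)" by (simp add: inner_add_right)
  then have N: "\<bar>rot v \<bullet> d\<bar> \<le> norm v * (B * h\<^sup>2)"
    using Cauchy_Schwarz_ineq2[of "rot v" "d + h *\<^sub>R v"] mult_left_mono[OF dv norm_ge_zero[of v]] by simp
  then have a: "\<bar>rot v \<bullet> d / norm v\<bar> \<le> B * h\<^sup>2"
    using v0 by (simp add: pos_divide_le_eq mult_ac)
  \<comment> \<open>The terms added on the right,
    \<open>h * (rot w \<bullet> v + rot v \<bullet> w)\<close>, sum to zero.\<close>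
  have "rot w \<bullet> d + rot v \<bullet> W = rot w \<bullet> (d + h *\<^sub>R v) + rot v \<bullet> (W + h *\<^sub>R w)"
    by (simp add: inner_vec2 algebra_simps)
  also have "\<bar>\<dots>\<bar> \<le> norm w * norm (d + h *\<^sub>R v) + norm v * norm (W + h *\<^sub>R w)"
    using Cauchy_Schwarz_ineq2[of "rot w" "d + h *\<^sub>R v"] Cauchy_Schwarz_ineq2[of "rot v" "W + h *\<^sub>R w"]
    by simp
  also have "\<dots> \<le> B * (B * h\<^sup>2) + B * (B * h\<^sup>2)"
    using v w dv Ww B by (intro add_mono mult_mono) auto
  finally have "\<bar>rot w \<bullet> d + rot v \<bullet> W\<bar> \<le> 2 * B\<^sup>2 * h\<^sup>2" by (simp add: power2_eq_square)
  then have N1: "\<bar>(rot w \<bullet> d + rot v \<bullet> W) / norm v\<bar> \<le> 2 * B\<^sup>2 * h\<^sup>2 / c"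
    using v c unfolding abs_divide abs_norm_cancel by (intro frac_le) auto
  have "\<bar>(rot v \<bullet> d) * (v \<bullet> w) / norm v ^ 3\<bar> = \<bar>rot v \<bullet> d\<bar> * \<bar>v \<bullet> w\<bar> / norm v ^ 3"
    by (simp add: abs_mult)
  also have "\<dots> \<le> (norm v * (B * h\<^sup>2)) * (norm v * B) / norm v ^ 3"
    using N Cauchy_Schwarz_ineq2[of v w] mult_left_mono[OF w(1) norm_ge_zero[of v]]
    by (intro divide_right_mono mult_mono) auto
  also have "\<dots> = B\<^sup>2 * h\<^sup>2 / norm v"
    using v0 by (simp add: field_simps power2_eq_square power3_eq_cube)
  also have "\<dots> \<le> B\<^sup>2 * h\<^sup>2 / c"
    using v v0 c by (intro divide_left_mono) auto
  finally have N2: "\<bar>(rot v \<bullet> d) * (v \<bullet> w) / norm v ^ 3\<bar> \<le> B\<^sup>2 * h\<^sup>2 / c" .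
  let ?A = "(rot w \<bullet> d + rot v \<bullet> W) / norm v - (rot v \<bullet> d) * (v \<bullet> w) / norm v ^ 3"
  have A: "\<bar>?A\<bar> \<le> 3 * B\<^sup>2 * h\<^sup>2 / c" using N1 N2 by linarith
  have "\<bar>u \<bullet> w'\<bar> \<le> norm u * B"
    using Cauchy_Schwarz_ineq2[of u w'] mult_left_mono[OF w(2) norm_ge_zero[of u]] by linarith
  then have b: "\<bar>u \<bullet> w' / norm u\<bar> \<le> B" using u0 by (simp add: field_simps)
  have d2: "c\<^sup>2 * h\<^sup>2 \<le> (norm d)\<^sup>2" using power_mono[OF d(1), of 2] c by (simp add: power_mult_distrib)
  have F2: "norm (F ((norm d)\<^sup>2)) \<le> M / (c\<^sup>2 * h\<^sup>2)"
    using F by (rule order_trans) (use d2 c h M in \<open>auto intro!: frac_le\<close>)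
  have F'2: "norm (F' ((norm d)\<^sup>2)) \<le> M / (c\<^sup>2 * h\<^sup>2)\<^sup>2"
    using F' by (rule order_trans) (use power_mono[OF d2, of 2] c h M in \<open>auto intro!: frac_le\<close>)
  have "\<bar>d \<bullet> W\<bar> \<le> norm d * norm W" by (rule Cauchy_Schwarz_ineq2)
  also have "\<dots> \<le> (B * \<bar>h\<bar>) * (B * \<bar>h\<bar>)" using d W B by (intro mult_mono) auto
  also have "\<dots> = B\<^sup>2 * h\<^sup>2" by (simp add: power2_eq_square)
  finally have dW: "\<bar>d \<bullet> W\<bar> \<le> B\<^sup>2 * h\<^sup>2" .
  have "norm (dkern F F' v d u w W w') \<le>
      \<bar>2 * ?A * norm u + 2 * (rot v \<bullet> d / norm v) * (u \<bullet> w' / norm u)\<bar> * norm (F ((norm d)\<^sup>2))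
     + \<bar>4 * (rot v \<bullet> d / norm v) * norm u * (d \<bullet> W)\<bar> * norm (F' ((norm d)\<^sup>2))"
    unfolding dkern_def by (intro norm_triangle_le add_mono) (simp_all only: norm_mult norm_of_real order_refl)
  \<comment> \<open>The coefficient of \<open>F\<close> is of order \<open>h^2\<close>, that of
    \<open>F'\<close> of order \<open>h^4\<close>, so all powers of \<open>h\<close> cancel. The
    number 6 is twice the 3 in the bound for \<open>?A\<close>, and the term
    \<open>2 * B\<^sup>2\<close> comes from the variation of \<open>norm u\<close>.\<close>
  also have "\<dots> \<le> ((6 * B ^ 3 / c + 2 * B\<^sup>2) * h\<^sup>2) * (M / (c\<^sup>2 * h\<^sup>2))
     + (4 * B ^ 4 * h ^ 4) * (M / (c\<^sup>2 * h\<^sup>2)\<^sup>2)"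
  proof (intro add_mono mult_mono F2 F'2)
    have "\<bar>2 * ?A * norm u\<bar> \<le> 2 * (3 * B\<^sup>2 * h\<^sup>2 / c) * B"
      unfolding abs_mult using A u B c by (intro mult_mono) auto
    moreover have "\<bar>2 * (rot v \<bullet> d / norm v) * (u \<bullet> w' / norm u)\<bar> \<le> 2 * (B * h\<^sup>2) * B"
      unfolding abs_mult using a b B by (intro mult_mono) auto
    moreover have "2 * (3 * B\<^sup>2 * h\<^sup>2 / c) * B + 2 * (B * h\<^sup>2) * B = (6 * B ^ 3 / c + 2 * B\<^sup>2) * h\<^sup>2"
      by (simp add: power2_eq_square power3_eq_cube algebra_simps)
    ultimately show "\<bar>2 * ?A * norm u + 2 * (rot v \<bullet> d / norm v) * (u \<bullet> w' / norm u)\<bar>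
        \<le> (6 * B ^ 3 / c + 2 * B\<^sup>2) * h\<^sup>2" by linarith
    have "\<bar>4 * (rot v \<bullet> d / norm v) * norm u * (d \<bullet> W)\<bar> \<le> 4 * (B * h\<^sup>2) * B * (B\<^sup>2 * h\<^sup>2)"
      unfolding abs_mult using a u dW B by (intro mult_mono) auto
    also have "\<dots> = 4 * B ^ 4 * h ^ 4" by (simp add: power2_eq_square power4_eq_xxxx)
    finally show "\<bar>4 * (rot v \<bullet> d / norm v) * norm u * (d \<bullet> W)\<bar> \<le> 4 * B ^ 4 * h ^ 4" .
  qed (use B c in auto)
  also have "\<dots> = (6 * B ^ 3 / c + 2 * B\<^sup>2) * M / c\<^sup>2 + 4 * B ^ 4 * M / c ^ 4"
    using h c by (simp add: field_simps power2_eq_square power4_eq_xxxx)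
  finally show ?thesis .
qed

section \<open>Smooth closed curves\<close>

text \<open>Continuity of \<open>f2\<close> comes from the level \<open>n = 2\<close> of
  \<open>smooth\<close>, that is from the existence of a third derivative.\<close>

lemma smooth_derivs:
  assumes "smooth f"
  obtains f1 f2 where "\<And>s. (f has_vector_derivative f1 s) (at s)"
    "\<And>s. (f1 has_vector_derivative f2 s) (at s)" "continuous_on UNIV f2"
    "f1 = (\<lambda>s. vector_derivative f (at s))"
proof
  define D :: "(real \<Rightarrow> 'a) \<Rightarrow> real \<Rightarrow> 'a" where "D = (\<lambda>g u. vector_derivative g (at u))"
  have d: "(D ^^ n) f differentiable (at s)" for n s
    using assms unfolding smooth_def D_def by blast
  show "(f has_vector_derivative D f s) (at s)" for s
    using d[of 0] by (simp add: D_def vector_derivative_works)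
  show "(D f has_vector_derivative D (D f) s) (at s)" for s
    using d[of 1] by (simp add: D_def vector_derivative_works)
  show "continuous_on UNIV (D (D f))"
    using d[of 2] by (auto simp: numeral_2_eq_2 intro!: continuous_at_imp_continuous_on differentiable_imp_continuous_within)
  show "D f = (\<lambda>s. vector_derivative f (at s))" by (simp add: D_def)
qed

lemma smooth_imp_has_vector_derivative:
  "smooth f \<Longrightarrow> (f has_vector_derivative vector_derivative f (at s)) (at s)"
  by (erule smooth_derivs) simp

lemma smooth_imp_continuous_on: "smooth f \<Longrightarrow> continuous_on S f"
  by (rule continuous_at_imp_continuous_on)
     (blast intro: has_vector_derivative_continuous smooth_imp_has_vector_derivative)

lemma smooth_imp_continuous_on_deriv:
  assumes "smooth f"
  shows "continuous_on S (\<lambda>s. vector_derivative f (at s))"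
proof -
  obtain f1 f2 where "\<And>s. (f1 has_vector_derivative f2 s) (at s)"
    and "f1 = (\<lambda>s. vector_derivative f (at s))"
    by (rule smooth_derivs[OF assms]) (rule that)
  then show ?thesis
    by (intro continuous_at_imp_continuous_on) (blast intro: has_vector_derivative_continuous)
qed

text \<open>The segment is unordered, so increments of either sign are covered.\<close>

lemma norm_diff_le_vector_derivative:
  fixes f :: "real \<Rightarrow> 'a::real_normed_vector"
  assumes "\<And>s. s \<in> closed_segment x y \<Longrightarrow> (f has_vector_derivative f' s) (at s)"
    and "\<And>s. s \<in> closed_segment x y \<Longrightarrow> norm (f' s) \<le> B"
  shows "norm (f y - f x) \<le> B * \<bar>y - x\<bar>"
proof -
  have "norm (f y - f x) \<le> B * norm (y - x)"
  proof (rule differentiable_bound[of "closed_segment x y"])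
    show "(f has_derivative (\<lambda>h. h *\<^sub>R f' s)) (at s within closed_segment x y)"
      if "s \<in> closed_segment x y" for s
      using assms(1)[OF that] by (simp add: has_vector_derivative_def has_derivative_at_withinI)
    show "onorm (\<lambda>h. h *\<^sub>R f' s) \<le> B" if "s \<in> closed_segment x y" for s
      using assms(2)[OF that] by (simp add: onorm_scaleR_left[OF bounded_linear_ident] onorm_id)
  qed auto
  then show ?thesis by simp
qed

lemma smooth_increment_bounds:
  fixes f :: "real \<Rightarrow> 'a::real_normed_vector"
  assumes "smooth f"
  obtains C where "C \<ge> 0"
    "\<And>h. \<bar>h\<bar> \<le> r \<Longrightarrow> norm (f (t + h) - f t) \<le> C * \<bar>h\<bar>"
    "\<And>h. \<bar>h\<bar> \<le> r \<Longrightarrow> norm (f (t + h) - f t - h *\<^sub>R vector_derivative f (at t)) \<le> C * h\<^sup>2"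
proof -
  obtain f1 f2 where f1: "\<And>s. (f has_vector_derivative f1 s) (at s)"
    and f2: "\<And>s. (f1 has_vector_derivative f2 s) (at s)" and f2c: "continuous_on UNIV f2"
    and f1_def: "f1 = (\<lambda>s. vector_derivative f (at s))"
    using smooth_derivs[OF assms] by blast
  have "continuous_on {t-r..t+r} f1"
    using f2 by (meson continuous_at_imp_continuous_on has_vector_derivative_continuous)
  then obtain B1 where B1: "B1 \<ge> 0" "\<And>x. x \<in> {t-r..t+r} \<Longrightarrow> norm (f1 x) \<le> B1"
    by (rule bounded_on_interval) blast
  have "continuous_on {t-r..t+r} f2"
    using f2c continuous_on_subset by blast
  then obtain B2 where B2: "B2 \<ge> 0" "\<And>x. x \<in> {t-r..t+r} \<Longrightarrow> norm (f2 x) \<le> B2"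
    by (rule bounded_on_interval) blast
  show ?thesis
  proof
    show "B1 + B2 \<ge> 0" using B1 B2 by simp
    fix h assume h: "\<bar>h\<bar> \<le> r"
    have seg: "closed_segment t (t + h) \<subseteq> {t-r..t+r}"
      using h by (auto simp: closed_segment_eq_real_ivl split: if_splits)
    have "norm (f (t + h) - f t) \<le> B1 * \<bar>t + h - t\<bar>"
      by (rule norm_diff_le_vector_derivative) (use f1 B1 seg in auto)
    also have "\<dots> \<le> (B1 + B2) * \<bar>h\<bar>" using B2 by (simp add: mult_right_mono)
    finally show "norm (f (t + h) - f t) \<le> (B1 + B2) * \<bar>h\<bar>" .
    have f1_le: "norm (f1 s - f1 t) \<le> B2 * \<bar>h\<bar>" if "s \<in> closed_segment t (t + h)" for s
    proof -
      have sub: "closed_segment t s \<subseteq> closed_segment t (t + h)"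
        using that by (simp add: subset_closed_segment)
      have "norm (f1 s - f1 t) \<le> B2 * \<bar>s - t\<bar>"
        by (rule norm_diff_le_vector_derivative) (use f2 B2 seg sub in auto)
      also have "\<dots> \<le> B2 * \<bar>h\<bar>"
        using that B2(1) by (intro mult_left_mono) (auto simp: closed_segment_eq_real_ivl split: if_splits)
      finally show ?thesis .
    qed
    \<comment> \<open>For vector values the quadratic remainder is obtained from the mean value
      inequality applied to \<open>\<lambda>s. f s - s *\<^sub>R f1 t\<close>, whose derivative
      \<open>f1 s - f1 t\<close> is itself at most \<open>B2 * \<bar>h\<bar>\<close>.\<close>
    have "norm ((f (t + h) - (t + h) *\<^sub>R f1 t) - (f t - t *\<^sub>R f1 t)) \<le> (B2 * \<bar>h\<bar>) * \<bar>t + h - t\<bar>"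
      by (rule norm_diff_le_vector_derivative[where f' = "\<lambda>s. f1 s - f1 t"])
         (use f1_le in \<open>auto intro!: derivative_eq_intros f1\<close>)
    also have "(f (t + h) - (t + h) *\<^sub>R f1 t) - (f t - t *\<^sub>R f1 t) = f (t + h) - f t - h *\<^sub>R f1 t"
      by (simp add: algebra_simps)
    also have "(B2 * \<bar>h\<bar>) * \<bar>t + h - t\<bar> = B2 * h\<^sup>2" by (simp add: power2_eq_square)
    also have "\<dots> \<le> (B1 + B2) * h\<^sup>2" using B1 by (intro mult_right_mono) auto
    finally show "norm (f (t + h) - f t - h *\<^sub>R vector_derivative f (at t)) \<le> (B1 + B2) * h\<^sup>2"
      by (simp add: f1_def)
  qed
qed

section \<open>Periodicity, simplicity and chord lengths\<close>

lemma periodic_mult_int: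
  assumes "periodic L f"
  shows "f (s + of_int n * L) = f s"
proof -
  have nat: "f (s + of_nat m * L) = f s" for s and m :: nat
  proof (induction m)
    case (Suc m)
    then show ?case
      using assms unfolding periodic_def by (metis add.assoc distrib_right mult_1 of_nat_Suc add.commute)
  qed simp
  show ?thesis
    using nat[of s "nat n"] nat[of "s + of_int n * L" "nat (- n)"] by (cases "n \<ge> 0") (auto simp: algebra_simps)
qed

text \<open>Parameters \<open>t + h\<close> may leave \<open>{0..L}\<close>, so injectivity is
  needed modulo the period. Reducing both parameters to \<open>{0..<L}\<close> by the floor function
  shows that equal values force \<open>x - y\<close> to be an integer multiple of
  \<open>L\<close>.\<close>

lemma simple_closed_curve_neq:
  assumes "periodic L \<gamma>" "inj_on \<gamma> {0..<L}" "0 < \<bar>x - y\<bar>" "\<bar>x - y\<bar> < L"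
  shows "\<gamma> x \<noteq> \<gamma> y"
proof
  assume eq: "\<gamma> x = \<gamma> y"
  have L: "L > 0" using assms by linarith
  define red where "red s = s - of_int \<lfloor>s / L\<rfloor> * L" for s
  have red: "red s \<in> {0..<L}" for s
    using floor_divide_lower[OF L, of s] floor_divide_upper[OF L, of s]
    by (simp add: red_def algebra_simps)
  have g: "\<gamma> (red s) = \<gamma> s" for s
    using periodic_mult_int[OF assms(1), of s "- \<lfloor>s / L\<rfloor>"] by (simp add: red_def)
  have "red x = red y" using inj_onD[OF assms(2) _ red red] eq g by metis
  then have "x - y = of_int (\<lfloor>x / L\<rfloor> - \<lfloor>y / L\<rfloor>) * L" by (simp add: red_def algebra_simps)
  then have xy: "\<bar>x - y\<bar> = of_int \<bar>\<lfloor>x / L\<rfloor> - \<lfloor>y / L\<rfloor>\<bar> * L"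
    using L by (simp add: abs_mult)
  define n where "n = \<bar>\<lfloor>x / L\<rfloor> - \<lfloor>y / L\<rfloor>\<bar>"
  have "0 < of_int n * L" "of_int n * L < 1 * L"
    using assms(3,4) unfolding xy n_def by simp_all
  then have "0 < n" "n < 1" using L by (simp_all only: zero_less_mult_iff mult_less_cancel_right) auto
  then show False by simp
qed

text \<open>A compactness argument: the difference quotient at \<open>t\<close>, extended by the
  derivative \<open>v\<close> at \<open>h = 0\<close>, is continuous. It vanishes nowhere on the
  compact interval, by regularity at \<open>0\<close> and by simplicity elsewhere, so its norm has a
  positive minimum, which serves as \<open>c\<close>.\<close>

lemma chord_lower_bound:
  fixes \<gamma> :: "real \<Rightarrow> 'a::real_normed_vector"
  assumes "continuous_on UNIV \<gamma>" and d: "(\<gamma> has_vector_derivative v) (at t)" and "v \<noteq> 0"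
    and p: "periodic L \<gamma>" "inj_on \<gamma> {0..<L}" and L: "L > 0"
  obtains c where "c > 0" "\<And>h. \<bar>h\<bar> \<le> L / 2 \<Longrightarrow> c * \<bar>h\<bar> \<le> norm (\<gamma> (t + h) - \<gamma> t)"
proof -
  define q where "q h = (if h = 0 then v else (\<gamma> (t + h) - \<gamma> t) /\<^sub>R h)" for h
  have "continuous_on UNIV (\<lambda>h. \<gamma> (t + h))"
    by (rule continuous_on_compose2[OF assms(1)]) (auto intro!: continuous_intros)
  then have \<gamma>_shift: "isCont (\<lambda>h. \<gamma> (t + h)) h" for h
    by (simp add: continuous_on_eq_continuous_at)
  have "isCont q h" for h
  proof (cases "h = 0")
    case True
    have lim: "((\<lambda>h. norm (\<gamma> (t + h) - \<gamma> t - h *\<^sub>R v) / norm h) \<longlongrightarrow> 0) (at 0)"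
      using d by (simp add: has_vector_derivative_def has_derivative_at)
    have eq: "norm (q h - v) = norm (\<gamma> (t + h) - \<gamma> t - h *\<^sub>R v) / norm h" if "h \<noteq> 0" for h
    proof -
      have "q h - v = inverse h *\<^sub>R (\<gamma> (t + h) - \<gamma> t - h *\<^sub>R v)"
        using that by (simp add: q_def scaleR_diff_right)
      then show ?thesis by (simp add: divide_inverse_commute)
    qed
    have "((\<lambda>h. norm (q h - v)) \<longlongrightarrow> 0) (at 0)"
      by (rule Lim_transform_eventually[OF lim]) (simp add: eventually_at_filter eq)
    then have "(q \<longlongrightarrow> v) (at 0)"
      by (rule LIM_zero_cancel[OF tendsto_norm_zero_cancel])
    moreover have "q 0 = v" by (simp add: q_def)
    ultimately show ?thesis unfolding isCont_def True by simp
  next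
    case False
    have "isCont (\<lambda>h. (\<gamma> (t + h) - \<gamma> t) /\<^sub>R h) h"
      using False \<gamma>_shift by (intro continuous_intros)
    moreover have "\<forall>\<^sub>F x in nhds h. q x = (\<gamma> (t + x) - \<gamma> t) /\<^sub>R x"
      using t1_space_nhds[OF False] by (rule eventually_mono) (auto simp: q_def)
    ultimately show ?thesis by (simp add: isCont_cong)
  qed
  then have "continuous_on {- (L / 2)..L / 2} (\<lambda>h. norm (q h))"
    by (intro continuous_on_norm continuous_at_imp_continuous_on) blast
  then obtain h0 where h0: "h0 \<in> {- (L / 2)..L / 2}" "\<And>h. h \<in> {- (L / 2)..L / 2} \<Longrightarrow> norm (q h0) \<le> norm (q h)"
    using continuous_attains_inf[of "{- (L / 2)..L / 2}" "\<lambda>h. norm (q h)"] L by auto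
  \<comment> \<open>Half a period stays strictly below a full one, so the closing coincidence of
    \<open>\<gamma> (t + L)\<close> with \<open>\<gamma> t\<close> is not reached.\<close>
  have "\<bar>h0\<bar> < L" using h0(1) L by (simp add: abs_if)
  then have "q h0 \<noteq> 0"
    using \<open>v \<noteq> 0\<close> h0(1) simple_closed_curve_neq[OF p, of "t + h0" t] L by (auto simp: q_def)
  show ?thesis
  proof
    show "norm (q h0) > 0" using \<open>q h0 \<noteq> 0\<close> by simp
    fix h :: real assume "\<bar>h\<bar> \<le> L / 2"
    then have "h \<in> {- (L / 2)..L / 2}" unfolding atLeastAtMost_iff by linarith
    from h0(2)[OF this] have "norm (q h0) * \<bar>h\<bar> \<le> norm (q h) * \<bar>h\<bar>" by (intro mult_right_mono) auto
    also have "\<dots> = norm (\<gamma> (t + h) - \<gamma> t)" by (simp add: q_def)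
    finally show "norm (q h0) * \<bar>h\<bar> \<le> norm (\<gamma> (t + h) - \<gamma> t)" .
  qed
qed

text \<open>Choosing the nearest translate of \<open>s\<close> makes \<open>h\<close> measure
  closeness on the closed curve. Excluding the end points ensures \<open>h \<noteq> 0\<close>: for
  \<open>t = 0\<close> and \<open>s = L\<close> the nearest translate of \<open>s\<close> would be
  \<open>t\<close> itself.\<close>

lemma near_period_representative:
  fixes s t L :: real
  assumes "s \<in> {0<..<L}" "t \<in> {0..L}" "s \<noteq> t"
  obtains h where "h \<noteq> 0" "\<bar>h\<bar> \<le> L / 2" "t + h \<in> {s - L, s, s + L}"
proof -
  consider "\<bar>s - t\<bar> \<le> L / 2" | "s - t > L / 2" | "s - t < - L / 2" by linarith
  then show ?thesis
  proof cases
    case 1 then show ?thesis using that[of "s - t"] assms by auto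
  next
    case 2 then show ?thesis using that[of "s - L - t"] assms by auto
  next
    case 3 then show ?thesis using that[of "s + L - t"] assms by auto
  qed
qed

section \<open>Dominated differentiation and principal values\<close>

lemma has_vector_derivative_iff_quotient:
  fixes f :: "real \<Rightarrow> 'a::real_normed_vector"
  shows "(f has_vector_derivative D) (at x) \<longleftrightarrow> ((\<lambda>y. (f y - f x) /\<^sub>R (y - x)) \<longlongrightarrow> D) (at x)"
proof -
  have eq: "norm ((f y - f x) - (y - x) *\<^sub>R D) / norm (y - x) = norm ((f y - f x) /\<^sub>R (y - x) - D)" if "y \<noteq> x" for y
  proof -
    have "(f y - f x) /\<^sub>R (y - x) - D = ((f y - f x) - (y - x) *\<^sub>R D) /\<^sub>R (y - x)"
      using that by (simp add: scaleR_diff_right)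
    then show ?thesis by (simp add: divide_inverse_commute)
  qed
  have "(f has_vector_derivative D) (at x) \<longleftrightarrow>
      ((\<lambda>y. norm ((f y - f x) - (y - x) *\<^sub>R D) / norm (y - x)) \<longlongrightarrow> 0) (at x)"
    unfolding has_vector_derivative_def has_derivative_iff_norm
    by (simp add: bounded_linear_scaleR_left)
  also have "\<dots> \<longleftrightarrow> ((\<lambda>y. norm ((f y - f x) /\<^sub>R (y - x) - D)) \<longlongrightarrow> 0) (at x)"
    by (intro tendsto_cong, unfold eventually_at_filter) (intro always_eventually allI impI eq)
  also have "\<dots> \<longleftrightarrow> ((\<lambda>y. (f y - f x) /\<^sub>R (y - x)) \<longlongrightarrow> D) (at x)"
    unfolding tendsto_norm_zero_iff by (rule LIM_zero_iff)
  finally show ?thesis .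
qed

text \<open>The mean value inequality turns the bound on \<open>f'\<close> into the same bound
  \<open>C\<close> for the difference quotients. Integrability of \<open>f' x0\<close> is a
  conclusion: it is a dominated limit of these quotients along any sequence tending to
  \<open>x0\<close>.\<close>

lemma leibniz_rule_dominated:
  fixes f :: "real \<Rightarrow> 'a::euclidean_space \<Rightarrow> 'b::euclidean_space"
  assumes e: "e > 0" and C: "(\<lambda>s. C) integrable_on S"
    and int: "\<And>x. \<bar>x - x0\<bar> < e \<Longrightarrow> f x integrable_on S"
    and deriv: "\<And>x s. \<bar>x - x0\<bar> < e \<Longrightarrow> s \<in> S \<Longrightarrow> ((\<lambda>x. f x s) has_vector_derivative f' x s) (at x)"
    and bound: "\<And>x s. \<bar>x - x0\<bar> < e \<Longrightarrow> s \<in> S \<Longrightarrow> norm (f' x s) \<le> (C::real)"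
  shows "f' x0 absolutely_integrable_on S"
    and "((\<lambda>x. integral S (f x)) has_vector_derivative integral S (f' x0)) (at x0)"
proof -
  have quot_int: "(\<lambda>s. (f x s - f x0 s) /\<^sub>R (x - x0)) integrable_on S" if "\<bar>x - x0\<bar> < e" for x
    using int[OF that] int[of x0] e by (intro integrable_cmul integrable_diff) auto
  have quot_le: "norm ((f x s - f x0 s) /\<^sub>R (x - x0)) \<le> C" if "\<bar>x - x0\<bar> < e" "x \<noteq> x0" "s \<in> S" for x s
  proof -
    have seg: "\<bar>z - x0\<bar> < e" if "z \<in> closed_segment x0 x" for z
      using that \<open>\<bar>x - x0\<bar> < e\<close> by (auto simp: closed_segment_eq_real_ivl split: if_splits)
    have "norm (f x s - f x0 s) \<le> C * \<bar>x - x0\<bar>"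
      by (rule norm_diff_le_vector_derivative[where f' = "\<lambda>x. f' x s"])
         (use deriv bound seg that in auto)
    then show ?thesis
      using that by (simp add: divide_inverse_commute[symmetric] pos_divide_le_eq)
  qed
  have quot_lim: "((\<lambda>x. (f x s - f x0 s) /\<^sub>R (x - x0)) \<longlongrightarrow> f' x0 s) (at x0)" if "s \<in> S" for s
    using deriv[of x0 s] e that by (simp add: has_vector_derivative_iff_quotient)
  have dom: "f' x0 integrable_on S"
      "(\<lambda>i. integral S (\<lambda>s. (f (X i) s - f x0 s) /\<^sub>R (X i - x0))) \<longlonglongrightarrow> integral S (f' x0)"
    if X: "\<And>i. X i \<in> ball x0 e - {x0}" "X \<longlonglongrightarrow> x0" for X :: "nat \<Rightarrow> real"
  proof -
    have X': "\<bar>X i - x0\<bar> < e" "X i \<noteq> x0" for i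
      using X(1)[of i] by (auto simp: dist_real_def abs_minus_commute)
    have lim: "(\<lambda>i. (f (X i) s - f x0 s) /\<^sub>R (X i - x0)) \<longlonglongrightarrow> f' x0 s" if "s \<in> S" for s
      using quot_lim[OF that] X' X(2) unfolding tendsto_at_iff_sequentially by (auto simp: o_def)
    note * = dominated_convergence[of "\<lambda>i s. (f (X i) s - f x0 s) /\<^sub>R (X i - x0)" S "\<lambda>_. C" "f' x0"]
    show "f' x0 integrable_on S"
      by (rule *(1)) (intro quot_int quot_le X' lim C; assumption)+
    show "(\<lambda>i. integral S (\<lambda>s. (f (X i) s - f x0 s) /\<^sub>R (X i - x0))) \<longlonglongrightarrow> integral S (f' x0)"
      by (rule *(2)) (intro quot_int quot_le X' lim C; assumption)+
  qed
  have "f' x0 integrable_on S"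
  proof (rule dom)
    \<comment> \<open>The shift by 2 keeps the point strictly inside the ball already for
      \<open>i = 0\<close>, where a shift by 1 would reach its boundary.\<close>
    show "x0 + e / (real i + 2) \<in> ball x0 e - {x0}" for i
    proof -
      have "e * 1 < e * (real i + 2)" using e by (intro mult_strict_left_mono) auto
      then have "e / (real i + 2) < e" by (simp add: pos_divide_less_eq)
      moreover have "0 < e / (real i + 2)" using e by simp
      ultimately show ?thesis by (simp add: dist_real_def)
    qed
    have "(\<lambda>i. e / real (i + 2)) \<longlonglongrightarrow> 0"
      by (intro LIMSEQ_ignore_initial_segment lim_const_over_n)
    from tendsto_add[OF tendsto_const this, of x0]
    show "(\<lambda>i. x0 + e / (real i + 2)) \<longlonglongrightarrow> x0" by (simp add: add.commute)
  qed
  then show "f' x0 absolutely_integrable_on S"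
    by (rule absolutely_integrable_integrable_bound[rotated]) (use bound e C in auto)
  \<comment> \<open>Restricting the filter to the ball keeps every test sequence where the
    hypotheses apply; the ball is open, so the limit is unchanged.\<close>
  have "((\<lambda>x. (integral S (f x) - integral S (f x0)) /\<^sub>R (x - x0)) \<longlongrightarrow> integral S (f' x0)) (at x0 within ball x0 e)"
    unfolding tendsto_at_iff_sequentially
  proof (intro allI impI)
    fix X assume X: "\<forall>i. X i \<in> ball x0 e - {x0}" "X \<longlonglongrightarrow> x0"
    have "integral S (\<lambda>s. (f (X i) s - f x0 s) /\<^sub>R (X i - x0))
        = (integral S (f (X i)) - integral S (f x0)) /\<^sub>R (X i - x0)" for i
    proof -
      have "\<bar>X i - x0\<bar> < e" using X(1) by (auto simp: dist_real_def abs_minus_commute)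
      then show ?thesis using int[of "X i"] int[of x0] e by (simp add: integral_diff)
    qed
    then show "((\<lambda>x. (integral S (f x) - integral S (f x0)) /\<^sub>R (x - x0)) \<circ> X) \<longlonglongrightarrow> integral S (f' x0)"
      using dom(2)[of X] X by (simp add: o_def)
  qed
  then show "((\<lambda>x. integral S (f x)) has_vector_derivative integral S (f' x0)) (at x0)"
    using e by (simp add: has_vector_derivative_iff_quotient at_within_open[of _ "ball x0 e"])
qed

text \<open>As the cutoff shrinks, the truncations exhaust the interval except for the parameters
  with \<open>\<gamma> s = \<gamma> t\<close>, which form a null set. Dominated convergence with
  majorant \<open>norm (f s)\<close> then applies.\<close>

lemma has_pv_integral_absolutely_integrable:
  assumes f: "f absolutely_integrable_on {0..L}" and \<gamma>: "continuous_on {0..L} \<gamma>"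
    and null: "negligible {s \<in> {0..L}. \<gamma> s = \<gamma> t}"
  shows "has_pv_integral L \<gamma> t f (integral {0..L} f)"
proof -
  have trunc: "f absolutely_integrable_on truncated L \<gamma> t \<delta>" for \<delta>
  proof (rule set_integrable_subset[OF f])
    have "openin (top_of_set {0..L}) ({0..L} \<inter> (\<lambda>s. dist (\<gamma> t) (\<gamma> s)) -` {\<delta><..})"
      by (intro continuous_openin_preimage_gen continuous_intros \<gamma>)
    then obtain T where "open T" "{0..L} \<inter> (\<lambda>s. dist (\<gamma> t) (\<gamma> s)) -` {\<delta><..} = {0..L} \<inter> T"
      by (auto simp: openin_open)
    moreover have "truncated L \<gamma> t \<delta> = {0..L} \<inter> (\<lambda>s. dist (\<gamma> t) (\<gamma> s)) -` {\<delta><..}"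
      by (auto simp: truncated_def)
    ultimately show "truncated L \<gamma> t \<delta> \<in> sets lebesgue" by simp
    show "truncated L \<gamma> t \<delta> \<subseteq> {0..L}" by (auto simp: truncated_def)
  qed
  have "((\<lambda>\<delta>. integral (truncated L \<gamma> t \<delta>) f) \<longlongrightarrow> integral {0..L} f) (at_right 0)"
    unfolding tendsto_at_iff_sequentially
  proof (intro allI impI)
    fix X :: "nat \<Rightarrow> real" assume X: "\<forall>i. X i \<in> {0<..} - {0}" "X \<longlonglongrightarrow> 0"
    \<comment> \<open>The pointwise limit of the truncated integrands: a parameter with
      \<open>\<gamma> s = \<gamma> t\<close> lies in no truncation, so the limit there is
      \<open>0\<close>.\<close>
    define g where "g s = (if \<gamma> s = \<gamma> t then 0 else f s)" for s
    have restrict: "integral {0..L} (\<lambda>s. if s \<in> truncated L \<gamma> t \<delta> then f s else 0) = integral (truncated L \<gamma> t \<delta>) f"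
      "(\<lambda>s. if s \<in> truncated L \<gamma> t \<delta> then f s else 0) integrable_on {0..L}" for \<delta>
    proof -
      have "truncated L \<gamma> t \<delta> \<inter> {0..L} = truncated L \<gamma> t \<delta>" by (auto simp: truncated_def)
      then show "integral {0..L} (\<lambda>s. if s \<in> truncated L \<gamma> t \<delta> then f s else 0) = integral (truncated L \<gamma> t \<delta>) f"
        "(\<lambda>s. if s \<in> truncated L \<gamma> t \<delta> then f s else 0) integrable_on {0..L}"
        using trunc[of \<delta>]
        by (simp_all add: integral_restrict_Int integrable_restrict_Int set_lebesgue_integral_eq_integral)
    qed
    have "(\<lambda>i. integral {0..L} (\<lambda>s. if s \<in> truncated L \<gamma> t (X i) then f s else 0)) \<longlonglongrightarrow> integral {0..L} g"
    proof (rule dominated_convergence[where h = "\<lambda>s. norm (f s)"])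
      show "(\<lambda>s. norm (f s)) integrable_on {0..L}"
        using f by (simp add: absolutely_integrable_on_def)
      fix s assume s: "s \<in> {0..L}"
      show "(\<lambda>i. if s \<in> truncated L \<gamma> t (X i) then f s else 0) \<longlonglongrightarrow> g s"
      proof (cases "\<gamma> s = \<gamma> t")
        case True
        have "s \<notin> truncated L \<gamma> t (X i)" for i
          using True X(1) by (auto simp: truncated_def not_less order_less_imp_le)
        then show ?thesis by (simp add: g_def True)
      next
        case False
        then have "\<forall>\<^sub>F i in sequentially. X i < dist (\<gamma> t) (\<gamma> s)"
          using X(2) by (intro order_tendstoD) auto
        then have "\<forall>\<^sub>F i in sequentially. (if s \<in> truncated L \<gamma> t (X i) then f s else 0) = g s"
          by (rule eventually_mono) (use False s in \<open>auto simp: truncated_def g_def\<close>)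
        then show ?thesis by (rule tendsto_eventually)
      qed
    qed (use restrict in auto)
    moreover have "integral {0..L} g = integral {0..L} f"
      by (rule integral_spike[OF null]) (auto simp: g_def)
    ultimately show "((\<lambda>\<delta>. integral (truncated L \<gamma> t \<delta>) f) \<circ> X) \<longlonglongrightarrow> integral {0..L} f"
      by (simp add: o_def restrict)
  qed
  with trunc show ?thesis by (simp add: has_pv_integral_def)
qed

lemma pv_integral_eq: "has_pv_integral L \<gamma> t f I \<Longrightarrow> pv_integral L \<gamma> t f = I"
  unfolding pv_integral_def
  by (rule the_equality) (auto simp: has_pv_integral_def intro: tendsto_unique[OF trivial_limit_at_right_real])

section \<open>The shape derivative\<close>

text \<open>Supplies the hypotheses of \<open>norm_kern_le\<close> and \<open>norm_dkern_le\<close>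
  with constants independent of \<open>\<epsilon>\<close> and \<open>s\<close>. In particular the
  perturbed curve does not return to its point at \<open>t\<close> for any \<open>s\<close> in
  \<open>{0<..<L} - {t}\<close>.\<close>

lemma perturbed_chord_bounds:
  assumes L: "L > 0" and \<gamma>: "smooth \<gamma>" "periodic L \<gamma>" "inj_on \<gamma> {0..<L}"
    and reg: "\<And>s. velocity \<gamma> s \<noteq> 0" and V: "smooth V" "periodic L V" and t: "t \<in> {0..L}"
  obtains e c B where "e > 0" "c > 0"
    "\<And>\<epsilon> s. \<bar>\<epsilon>\<bar> < e \<Longrightarrow> s \<in> {0..L} \<Longrightarrow>
       c \<le> norm (velocity \<gamma> s + \<epsilon> *\<^sub>R velocity V s) \<and>
       norm (velocity \<gamma> s + \<epsilon> *\<^sub>R velocity V s) \<le> B \<and> norm (velocity V s) \<le> B"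
    "\<And>\<epsilon> s. \<bar>\<epsilon>\<bar> < e \<Longrightarrow> s \<in> {0<..<L} - {t} \<Longrightarrow>
       \<exists>h. h \<noteq> 0 \<and> \<bar>h\<bar> \<le> L \<and>
         norm ((\<gamma> t - \<gamma> s + \<epsilon> *\<^sub>R (V t - V s)) + h *\<^sub>R (velocity \<gamma> t + \<epsilon> *\<^sub>R velocity V t)) \<le> B * h\<^sup>2 \<and>
         norm ((V t - V s) + h *\<^sub>R velocity V t) \<le> B * h\<^sup>2 \<and>
         c * \<bar>h\<bar> \<le> norm (\<gamma> t - \<gamma> s + \<epsilon> *\<^sub>R (V t - V s)) \<and>
         norm (\<gamma> t - \<gamma> s + \<epsilon> *\<^sub>R (V t - V s)) \<le> B * \<bar>h\<bar> \<and>
         norm (V t - V s) \<le> B * \<bar>h\<bar>"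
proof -
  have vel: "velocity f = (\<lambda>s. vector_derivative f (at s))" for f
    by (simp add: velocity_def fun_eq_iff)
  obtain c1 where c1: "c1 > 0" "\<And>h. \<bar>h\<bar> \<le> L / 2 \<Longrightarrow> c1 * \<bar>h\<bar> \<le> norm (\<gamma> (t + h) - \<gamma> t)"
    using chord_lower_bound[OF smooth_imp_continuous_on[OF \<gamma>(1)]
        smooth_imp_has_vector_derivative[OF \<gamma>(1), of t] _ \<gamma>(2,3) L] reg[of t]
    unfolding vel by blast
  obtain A1 where A1: "A1 \<ge> 0"
    "\<And>h. \<bar>h\<bar> \<le> L / 2 \<Longrightarrow> norm (\<gamma> (t + h) - \<gamma> t) \<le> A1 * \<bar>h\<bar>"
    "\<And>h. \<bar>h\<bar> \<le> L / 2 \<Longrightarrow> norm (\<gamma> (t + h) - \<gamma> t - h *\<^sub>R velocity \<gamma> t) \<le> A1 * h\<^sup>2"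
    using smooth_increment_bounds[OF \<gamma>(1), of "L / 2" t] unfolding vel by blast
  obtain A2 where A2: "A2 \<ge> 0"
    "\<And>h. \<bar>h\<bar> \<le> L / 2 \<Longrightarrow> norm (V (t + h) - V t) \<le> A2 * \<bar>h\<bar>"
    "\<And>h. \<bar>h\<bar> \<le> L / 2 \<Longrightarrow> norm (V (t + h) - V t - h *\<^sub>R velocity V t) \<le> A2 * h\<^sup>2"
    using smooth_increment_bounds[OF V(1), of "L / 2" t] unfolding vel by blast
  have cont: "continuous_on {0..L} (velocity \<gamma>)" "continuous_on {0..L} (velocity V)"
    unfolding vel using \<gamma>(1) V(1) by (simp_all add: smooth_imp_continuous_on_deriv)
  obtain A3 where A3: "A3 \<ge> 0" "\<And>s. s \<in> {0..L} \<Longrightarrow> norm (velocity \<gamma> s) \<le> A3"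
    using bounded_on_interval[OF cont(1)] by blast
  obtain A4 where A4: "A4 \<ge> 0" "\<And>s. s \<in> {0..L} \<Longrightarrow> norm (velocity V s) \<le> A4"
    using bounded_on_interval[OF cont(2)] by blast
  have "\<exists>s0\<in>{0..L}. \<forall>s\<in>{0..L}. norm (velocity \<gamma> s0) \<le> norm (velocity \<gamma> s)"
    using L by (intro continuous_attains_inf continuous_on_norm cont) auto
  then obtain c2 where c2: "c2 > 0" "\<And>s. s \<in> {0..L} \<Longrightarrow> c2 \<le> norm (velocity \<gamma> s)"
    using reg by (metis zero_less_norm_iff)
  \<comment> \<open>Halving leaves room for the perturbation: unperturbed chords and speeds are at
    least twice the final bound, and the choice of \<open>e\<close> below lets
    \<open>\<epsilon>\<close> consume at most half. The entry \<open>1\<close> in \<open>e\<close>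
    keeps the upper bounds additive; \<open>B + 1\<close> avoids division by zero.\<close>
  define c where "c = min c1 c2 / 2"
  define B where "B = A1 + A2 + A3 + A4"
  define e where "e = min 1 (c / (B + 1))"
  have c: "c > 0" "2 * c \<le> c1" "2 * c \<le> c2" using c1(1) c2(1) by (auto simp: c_def)
  have B: "B \<ge> 0" using A1 A2 A3 A4 by (simp add: B_def)
  have e: "e > 0" using c B by (simp add: e_def)
  have scale: "norm (\<epsilon> *\<^sub>R x) \<le> a" "norm (\<epsilon> *\<^sub>R x) \<le> c * b"
    if \<epsilon>: "\<bar>\<epsilon>\<bar> < e" and x: "norm x \<le> a" "norm x \<le> B * b" "0 \<le> b" for \<epsilon> x and a b :: real
  proof -
    have "\<bar>\<epsilon>\<bar> * norm x \<le> 1 * norm x" using \<epsilon> by (intro mult_right_mono) (auto simp: e_def)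
    then show "norm (\<epsilon> *\<^sub>R x) \<le> a" using x by simp
    have "\<bar>\<epsilon>\<bar> * norm x \<le> (c / (B + 1)) * (B * b)"
      using \<epsilon> x c B by (intro mult_mono) (auto simp: e_def)
    also have "\<dots> = c * b * (B / (B + 1))" by simp
    also have "\<dots> \<le> c * b * 1" using B c x by (intro mult_left_mono) auto
    finally show "norm (\<epsilon> *\<^sub>R x) \<le> c * b" by simp
  qed
  show ?thesis
  proof
    show "e > 0" "c > 0" by fact+
  next
    fix \<epsilon> s :: real assume \<epsilon>: "\<bar>\<epsilon>\<bar> < e" and s: "s \<in> {0..L}"
    have "norm (\<epsilon> *\<^sub>R velocity V s) \<le> A4" "norm (\<epsilon> *\<^sub>R velocity V s) \<le> c * 1"
      using scale[OF \<epsilon>, of "velocity V s" A4 1] A4(2)[OF s] A1 A2 A3 by (simp_all add: B_def)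
    then show "c \<le> norm (velocity \<gamma> s + \<epsilon> *\<^sub>R velocity V s) \<and>
       norm (velocity \<gamma> s + \<epsilon> *\<^sub>R velocity V s) \<le> B \<and> norm (velocity V s) \<le> B"
      using norm_triangle_ineq[of "velocity \<gamma> s" "\<epsilon> *\<^sub>R velocity V s"]
        norm_diff_ineq[of "velocity \<gamma> s" "\<epsilon> *\<^sub>R velocity V s"]
        c c2(2)[OF s] A1(1) A2(1) A3(1) A3(2)[OF s] A4(2)[OF s] unfolding B_def by linarith
  next
    fix \<epsilon> s :: real assume \<epsilon>: "\<bar>\<epsilon>\<bar> < e" and "s \<in> {0<..<L} - {t}"
    then obtain h where h: "h \<noteq> 0" "\<bar>h\<bar> \<le> L / 2" "t + h \<in> {s - L, s, s + L}"
      using near_period_representative[of s L t] t by auto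
    \<comment> \<open>Periodicity replaces the source parameter by \<open>t + h\<close> for
      \<open>\<gamma>\<close> and \<open>V\<close> alike, so increments across the end points of the
      interval count as short ones.\<close>
    have shift: "f s = f (t + h)" if "periodic L f" for f :: "real \<Rightarrow> real^2"
      using h(3) that unfolding periodic_def by (metis diff_add_cancel insertE singletonD)
    define g where "g = \<gamma> (t + h) - \<gamma> t"
    define W where "W = V (t + h) - V t"
    have g: "norm g \<le> A1 * \<bar>h\<bar>" "norm (g - h *\<^sub>R velocity \<gamma> t) \<le> A1 * h\<^sup>2" "c1 * \<bar>h\<bar> \<le> norm g"
      using A1 c1(2) h(2) by (simp_all add: g_def)
    have W: "norm W \<le> A2 * \<bar>h\<bar>" "norm (W - h *\<^sub>R velocity V t) \<le> A2 * h\<^sup>2"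
      using A2 h(2) by (simp_all add: W_def)
    have WB: "norm W \<le> B * \<bar>h\<bar>" "norm (W - h *\<^sub>R velocity V t) \<le> B * h\<^sup>2"
      using W A1 A3 A4 by (auto simp: B_def intro: order_trans[OF _ mult_right_mono])
    have \<epsilon>W: "norm (\<epsilon> *\<^sub>R W) \<le> A2 * \<bar>h\<bar>" "norm (\<epsilon> *\<^sub>R W) \<le> c * \<bar>h\<bar>"
      using scale[OF \<epsilon> W(1) WB(1)] by simp_all
    have \<epsilon>Wh: "norm (\<epsilon> *\<^sub>R (W - h *\<^sub>R velocity V t)) \<le> A2 * h\<^sup>2"
      using scale(1)[OF \<epsilon> W(2) WB(2)] by simp
    have "norm (g + \<epsilon> *\<^sub>R W) \<le> (A1 + A2) * \<bar>h\<bar>"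
      using norm_triangle_ineq[of g "\<epsilon> *\<^sub>R W"] g \<epsilon>W by (simp add: algebra_simps)
    also have "\<dots> \<le> B * \<bar>h\<bar>" using A3 A4 by (intro mult_right_mono) (auto simp: B_def)
    finally have 1: "norm (g + \<epsilon> *\<^sub>R W) \<le> B * \<bar>h\<bar>" .
    have "2 * c * \<bar>h\<bar> \<le> norm g" using g(3) mult_right_mono[OF c(2), of "\<bar>h\<bar>"] by linarith
    then have 2: "c * \<bar>h\<bar> \<le> norm (g + \<epsilon> *\<^sub>R W)"
      using norm_diff_ineq[of g "\<epsilon> *\<^sub>R W"] \<epsilon>W by linarith
    have "norm ((g - h *\<^sub>R velocity \<gamma> t) + \<epsilon> *\<^sub>R (W - h *\<^sub>R velocity V t)) \<le> (A1 + A2) * h\<^sup>2"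
      using norm_triangle_ineq[of "g - h *\<^sub>R velocity \<gamma> t" "\<epsilon> *\<^sub>R (W - h *\<^sub>R velocity V t)"] g \<epsilon>Wh
      by (simp add: algebra_simps)
    also have "\<dots> \<le> B * h\<^sup>2" using A3 A4 by (intro mult_right_mono) (auto simp: B_def)
    finally have 3: "norm ((g - h *\<^sub>R velocity \<gamma> t) + \<epsilon> *\<^sub>R (W - h *\<^sub>R velocity V t)) \<le> B * h\<^sup>2" .
    \<comment> \<open>The chord runs from source to target and is therefore minus the increment in
      \<open>h\<close>.\<close>
    have neg: "\<gamma> t - \<gamma> s + \<epsilon> *\<^sub>R (V t - V s) = - (g + \<epsilon> *\<^sub>R W)" "V t - V s = - W"
      by (simp_all add: shift[OF \<gamma>(2)] shift[OF V(2)] g_def W_def algebra_simps)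
    have neg2: "- (g + \<epsilon> *\<^sub>R W) + h *\<^sub>R (velocity \<gamma> t + \<epsilon> *\<^sub>R velocity V t)
        = - ((g - h *\<^sub>R velocity \<gamma> t) + \<epsilon> *\<^sub>R (W - h *\<^sub>R velocity V t))"
       "- W + h *\<^sub>R velocity V t = - (W - h *\<^sub>R velocity V t)"
      by (simp_all add: algebra_simps)
    have "norm ((\<gamma> t - \<gamma> s + \<epsilon> *\<^sub>R (V t - V s)) + h *\<^sub>R (velocity \<gamma> t + \<epsilon> *\<^sub>R velocity V t)) \<le> B * h\<^sup>2"
      unfolding neg(1) neg2(1) norm_minus_cancel by (rule 3)
    moreover have "norm ((V t - V s) + h *\<^sub>R velocity V t) \<le> B * h\<^sup>2"
      unfolding neg(2) neg2(2) norm_minus_cancel by (rule WB)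
    moreover have "c * \<bar>h\<bar> \<le> norm (\<gamma> t - \<gamma> s + \<epsilon> *\<^sub>R (V t - V s))"
      unfolding neg(1) norm_minus_cancel by (rule 2)
    moreover have "norm (\<gamma> t - \<gamma> s + \<epsilon> *\<^sub>R (V t - V s)) \<le> B * \<bar>h\<bar>"
      unfolding neg(1) norm_minus_cancel by (rule 1)
    moreover have "norm (V t - V s) \<le> B * \<bar>h\<bar>"
      unfolding neg(2) norm_minus_cancel by (rule WB)
    moreover have "\<bar>h\<bar> \<le> L" using h L by linarith
    ultimately show "\<exists>h. h \<noteq> 0 \<and> \<bar>h\<bar> \<le> L \<and>
         norm ((\<gamma> t - \<gamma> s + \<epsilon> *\<^sub>R (V t - V s)) + h *\<^sub>R (velocity \<gamma> t + \<epsilon> *\<^sub>R velocity V t)) \<le> B * h\<^sup>2 \<and>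
         norm ((V t - V s) + h *\<^sub>R velocity V t) \<le> B * h\<^sup>2 \<and>
         c * \<bar>h\<bar> \<le> norm (\<gamma> t - \<gamma> s + \<epsilon> *\<^sub>R (V t - V s)) \<and>
         norm (\<gamma> t - \<gamma> s + \<epsilon> *\<^sub>R (V t - V s)) \<le> B * \<bar>h\<bar> \<and>
         norm (V t - V s) \<le> B * \<bar>h\<bar>"
      using h(1) by blast
  qed
qed

section \<open>Identification of the operator and of the three kernels with \<open>kern\<close> and
  \<open>dkern\<close>\<close>

lemma velocity_perturbed:
  assumes "smooth \<gamma>" "smooth V"
  shows "velocity (perturbed \<gamma> V \<epsilon>) s = velocity \<gamma> s + \<epsilon> *\<^sub>R velocity V s"
  unfolding velocity_def perturbed_def[abs_def]
  by (rule vector_derivative_at)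
     (auto intro!: derivative_eq_intros smooth_imp_has_vector_derivative assms)

lemma grad_G_eq:
  assumes G: "\<And>x y. x \<noteq> y \<Longrightarrow> helmholtz_G k x y = E ((norm (x - y))\<^sup>2)"
    and E: "\<And>\<rho>. \<rho> > 0 \<Longrightarrow> (E has_vector_derivative F \<rho>) (at \<rho>)"
    and ne: "x \<noteq> y"
  shows "grad_G k x y = (\<chi> i. of_real (2 * (x - y) $ i) * F ((norm (x - y))\<^sup>2))"
  by (rule gradient_radial[OF G E ne])

lemma hess_G_eq:
  assumes G: "\<And>x y. x \<noteq> y \<Longrightarrow> helmholtz_G k x y = E ((norm (x - y))\<^sup>2)"
    and E: "\<And>\<rho>. \<rho> > 0 \<Longrightarrow> (E has_vector_derivative F \<rho>) (at \<rho>)"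
    and F: "\<And>\<rho>. \<rho> > 0 \<Longrightarrow> (F has_vector_derivative F' \<rho>) (at \<rho>)"
    and ne: "x \<noteq> y"
  shows "hess_G k x y = (\<chi> i j. of_real (if i = j then 2 else 0) * F ((norm (x - y))\<^sup>2)
           + of_real (4 * (x - y) $ i * (x - y) $ j) * F' ((norm (x - y))\<^sup>2))"
  by (rule hessian_radial[OF G E F ne])

lemma S'_integrand_eq_kern:
  assumes G: "\<And>x y. x \<noteq> y \<Longrightarrow> helmholtz_G k x y = E ((norm (x - y))\<^sup>2)"
    and E: "\<And>\<rho>. \<rho> > 0 \<Longrightarrow> (E has_vector_derivative F \<rho>) (at \<rho>)"
    and ne: "\<gamma> t \<noteq> \<gamma> s"
  shows "S'_integrand k \<gamma> \<sigma> t s = kern F (velocity \<gamma> t) (\<gamma> t - \<gamma> s) (velocity \<gamma> s) * \<sigma> s"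
proof -
  have grad: "grad_G k (\<gamma> t) (\<gamma> s) = (\<chi> i. of_real (2 * (\<gamma> t - \<gamma> s) $ i) * F ((norm (\<gamma> t - \<gamma> s))\<^sup>2))"
    by (rule grad_G_eq[OF G E ne])
  show ?thesis
    unfolding S'_integrand_def grad dotc_radial_gradient[of _ "\<gamma> t - \<gamma> s"]
    by (simp add: kern_def unit_normal_def unit_tangent_def speed_def rot_linear divide_inverse mult_ac)
qed

text \<open>Each kernel is one part of the product rule. In the quotient rule for
  \<open>rot v /\<^sub>R norm v\<close> the numerator gives \<open>U1\<close>, and the variation of
  \<open>norm v\<close> gives the target half of \<open>U3\<close>. The variation \<open>W\<close>
  of the chord moves the argument of the gradient and gives \<open>U2\<close>. The variation of
  \<open>norm u\<close> gives the source half of \<open>U3\<close>; the factor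
  \<open>speed \<gamma> s\<close> on the left turns it into
  \<open>u \<bullet> w' / norm u\<close>.\<close>

lemma U_sum_eq_dkern:
  assumes G: "\<And>x y. x \<noteq> y \<Longrightarrow> helmholtz_G k x y = E ((norm (x - y))\<^sup>2)"
    and E: "\<And>\<rho>. \<rho> > 0 \<Longrightarrow> (E has_vector_derivative F \<rho>) (at \<rho>)"
    and F: "\<And>\<rho>. \<rho> > 0 \<Longrightarrow> (F has_vector_derivative F' \<rho>) (at \<rho>)"
    and ne: "\<gamma> t \<noteq> \<gamma> s" and reg: "velocity \<gamma> t \<noteq> 0" "velocity \<gamma> s \<noteq> 0"
  shows "(U1 k \<gamma> V t s + U2 k \<gamma> V t s + U3 k \<gamma> V t s) * complex_of_real (speed \<gamma> s)
    = dkern F F' (velocity \<gamma> t) (\<gamma> t - \<gamma> s) (velocity \<gamma> s) (velocity V t) (V t - V s) (velocity V s)"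
proof -
  have grad: "grad_G k (\<gamma> t) (\<gamma> s) = (\<chi> i. of_real (2 * (\<gamma> t - \<gamma> s) $ i) * F ((norm (\<gamma> t - \<gamma> s))\<^sup>2))"
    by (rule grad_G_eq[OF G E ne])
  have hess: "hess_G k (\<gamma> t) (\<gamma> s) = (\<chi> i j. of_real (if i = j then 2 else 0) * F ((norm (\<gamma> t - \<gamma> s))\<^sup>2)
      + of_real (4 * (\<gamma> t - \<gamma> s) $ i * (\<gamma> t - \<gamma> s) $ j) * F' ((norm (\<gamma> t - \<gamma> s))\<^sup>2))"
    by (rule hess_G_eq[OF G E F ne])
  define v d u w W w' where defs: "v = velocity \<gamma> t" "d = \<gamma> t - \<gamma> s" "u = velocity \<gamma> s"
    "w = velocity V t" "W = V t - V s" "w' = velocity V s"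
  have nz: "norm v \<noteq> 0" "norm u \<noteq> 0" using reg by (simp_all add: defs)
  have n: "unit_normal \<gamma> t = rot v /\<^sub>R norm v"
    by (simp add: unit_normal_def unit_tangent_def speed_def rot_linear defs)
  have a: "rot (tangential_deriv \<gamma> V t) = rot w /\<^sub>R norm v"
    by (simp add: tangential_deriv_def speed_def rot_linear defs velocity_def)
  have b: "unit_tangent \<gamma> s \<bullet> tangential_deriv \<gamma> V s - unit_tangent \<gamma> t \<bullet> tangential_deriv \<gamma> V t
      = (u \<bullet> w') / (norm u)\<^sup>2 - (v \<bullet> w) / (norm v)\<^sup>2"
    unfolding unit_tangent_def tangential_deriv_def speed_def velocity_def[of V, symmetric] defs[symmetric]
    by (simp add: divide_inverse power2_eq_square mult_ac)
  have 1: "U1 k \<gamma> V t s = of_real (2 * (rot w \<bullet> d) / norm v) * F ((norm d)\<^sup>2)"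
    unfolding U1_def a grad dotc_radial_gradient[of _ "\<gamma> t - \<gamma> s"]
    by (simp add: defs(2) divide_inverse mult_ac)
  have 2: "U2 k \<gamma> V t s = of_real (2 * (rot v \<bullet> W) / norm v) * F ((norm d)\<^sup>2)
      + of_real (4 * (rot v \<bullet> d) / norm v * (d \<bullet> W)) * F' ((norm d)\<^sup>2)"
    unfolding U2_def n hess dotc_radial_hessian[of _ _ "\<gamma> t - \<gamma> s"]
    by (simp add: defs(2,5) divide_inverse mult_ac)
  have 3: "U3 k \<gamma> V t s = of_real (2 * (rot v \<bullet> d) / norm v * ((u \<bullet> w') / (norm u)\<^sup>2 - (v \<bullet> w) / (norm v)\<^sup>2))
      * F ((norm d)\<^sup>2)"
    unfolding U3_def n b grad dotc_radial_gradient[of _ "\<gamma> t - \<gamma> s"]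
    by (simp add: defs(2) divide_inverse mult_ac)
  have "(U1 k \<gamma> V t s + U2 k \<gamma> V t s + U3 k \<gamma> V t s) * complex_of_real (norm u)
     = of_real ((2 * (rot w \<bullet> d) / norm v + 2 * (rot v \<bullet> W) / norm v
         + 2 * (rot v \<bullet> d) / norm v * ((u \<bullet> w') / (norm u)\<^sup>2 - (v \<bullet> w) / (norm v)\<^sup>2)) * norm u) * F ((norm d)\<^sup>2)
       + of_real (4 * (rot v \<bullet> d) / norm v * (d \<bullet> W) * norm u) * F' ((norm d)\<^sup>2)"
    unfolding 1 2 3 of_real_add of_real_mult by (simp only: algebra_simps)
  also have "(2 * (rot w \<bullet> d) / norm v + 2 * (rot v \<bullet> W) / norm v
         + 2 * (rot v \<bullet> d) / norm v * ((u \<bullet> w') / (norm u)\<^sup>2 - (v \<bullet> w) / (norm v)\<^sup>2)) * norm u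
       = 2 * ((rot w \<bullet> d + rot v \<bullet> W) / norm v - (rot v \<bullet> d) * (v \<bullet> w) / norm v ^ 3) * norm u
            + 2 * (rot v \<bullet> d / norm v) * (u \<bullet> w' / norm u)"
    using nz by (simp add: field_simps power2_eq_square power3_eq_cube)
  also have "4 * (rot v \<bullet> d) / norm v * (d \<bullet> W) * norm u = 4 * (rot v \<bullet> d / norm v) * norm u * (d \<bullet> W)"
    by simp
  finally show ?thesis by (simp add: dkern_def speed_def defs)
qed

theorem lemma13:
  fixes \<Omega> :: "(real^2) set"
    and \<gamma> V :: "real \<Rightarrow> real^2"
    and \<sigma> :: "real \<Rightarrow> complex"
    and L k t :: real
  assumes "open \<Omega>" and "connected \<Omega>" and "bounded \<Omega>" and "\<Omega> \<noteq> {}"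
    and "L > 0"
    and "smooth \<gamma>" and "periodic L \<gamma>"
    and "\<And>s. velocity \<gamma> s \<noteq> 0"
    and "inj_on \<gamma> {0..<L}"
    and "\<gamma> ` {0..L} = frontier \<Omega>"
    and "counterclockwise_around L \<gamma> \<Omega>"
    and "k > 0"
    and "smooth V" and "periodic L V"
    and "smooth \<sigma>"
    and "t \<in> {0..L}"
  shows "(\<forall>\<^sub>F \<epsilon> in nhds 0. \<exists>I. has_pv_integral L (perturbed \<gamma> V \<epsilon>) t
            (S'_integrand k (perturbed \<gamma> V \<epsilon>) \<sigma> t) I)
    \<and> (\<lambda>s. (U1 k \<gamma> V t s + U2 k \<gamma> V t s + U3 k \<gamma> V t s) * \<sigma> s * complex_of_real (speed \<gamma> s))
          absolutely_integrable_on {0..L}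
    \<and> ((\<lambda>\<epsilon>. S' k L (perturbed \<gamma> V \<epsilon>) \<sigma> t) has_vector_derivative
          integral {0..L} (\<lambda>s. (U1 k \<gamma> V t s + U2 k \<gamma> V t s + U3 k \<gamma> V t s)
                                * \<sigma> s * complex_of_real (speed \<gamma> s)))
        (at 0)"
proof -
  note L = \<open>L > 0\<close> and \<gamma> = \<open>smooth \<gamma>\<close> \<open>periodic L \<gamma>\<close> \<open>inj_on \<gamma> {0..<L}\<close>
    and reg = \<open>\<And>s. velocity \<gamma> s \<noteq> 0\<close> and V = \<open>smooth V\<close> \<open>periodic L V\<close>
    and t = \<open>t \<in> {0..L}\<close> and \<sigma> = \<open>smooth \<sigma>\<close>
  obtain E F F' where G: "\<And>x y. x \<noteq> y \<Longrightarrow> helmholtz_G k x y = E ((norm (x - y))\<^sup>2)"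
    and E: "\<And>\<rho>. \<rho> > 0 \<Longrightarrow> (E has_vector_derivative F \<rho>) (at \<rho>)"
    and F: "\<And>\<rho>. \<rho> > 0 \<Longrightarrow> (F has_vector_derivative F' \<rho>) (at \<rho>)"
    and FM: "\<And>R. \<exists>M\<ge>0. \<forall>\<rho>\<in>{0<..R}. norm (F \<rho>) \<le> M / \<rho> \<and> norm (F' \<rho>) \<le> M / \<rho>\<^sup>2"
    by (rule helmholtz_G_radial[OF \<open>k > 0\<close>]) (rule that)
  obtain e c B where e: "e > 0" and c: "c > 0"
    and vel: "\<And>\<epsilon> s. \<bar>\<epsilon>\<bar> < e \<Longrightarrow> s \<in> {0..L} \<Longrightarrow>
       c \<le> norm (velocity \<gamma> s + \<epsilon> *\<^sub>R velocity V s) \<and>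
       norm (velocity \<gamma> s + \<epsilon> *\<^sub>R velocity V s) \<le> B \<and> norm (velocity V s) \<le> B"
    and chord: "\<And>\<epsilon> s. \<bar>\<epsilon>\<bar> < e \<Longrightarrow> s \<in> {0<..<L} - {t} \<Longrightarrow>
       \<exists>h. h \<noteq> 0 \<and> \<bar>h\<bar> \<le> L \<and>
         norm ((\<gamma> t - \<gamma> s + \<epsilon> *\<^sub>R (V t - V s)) + h *\<^sub>R (velocity \<gamma> t + \<epsilon> *\<^sub>R velocity V t)) \<le> B * h\<^sup>2 \<and>
         norm ((V t - V s) + h *\<^sub>R velocity V t) \<le> B * h\<^sup>2 \<and>
         c * \<bar>h\<bar> \<le> norm (\<gamma> t - \<gamma> s + \<epsilon> *\<^sub>R (V t - V s)) \<and>
         norm (\<gamma> t - \<gamma> s + \<epsilon> *\<^sub>R (V t - V s)) \<le> B * \<bar>h\<bar> \<and>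
         norm (V t - V s) \<le> B * \<bar>h\<bar>"
    using perturbed_chord_bounds[OF L \<gamma> reg V t] by blast
  have B: "B \<ge> 0" using vel[of 0 t] e t norm_ge_zero[of "velocity V t"] by (smt (verit))
  \<comment> \<open>Chords are at most \<open>B * \<bar>h\<bar>\<close> with
    \<open>\<bar>h\<bar> \<le> L\<close>, so this range contains all squared distances that
    occur.\<close>
  obtain M where M: "M \<ge> 0" "\<And>\<rho>. \<rho> \<in> {0<..(B * L)\<^sup>2} \<Longrightarrow> norm (F \<rho>) \<le> M / \<rho> \<and> norm (F' \<rho>) \<le> M / \<rho>\<^sup>2"
    using FM[of "(B * L)\<^sup>2"] by blast
  obtain A where A: "A \<ge> 0" "\<And>s. s \<in> {0..L} \<Longrightarrow> norm (\<sigma> s) \<le> A"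
    using bounded_on_interval[OF smooth_imp_continuous_on[OF \<sigma>]] by blast

  \<comment> \<open>Off these at most three parameters the kernel formulas and all bounds hold. The
    end points are removed together with \<open>t\<close>, since for \<open>t = 0\<close> or
    \<open>t = L\<close> they are the same point of the curve. The removed set is null, so integrals
    do not change.\<close>
  define T where "T = {0<..<L} - {t}"
  have T: "T \<subseteq> {0..L}" "T \<in> sets lebesgue" by (auto simp: T_def)
  have null: "negligible X" if "X \<subseteq> {0, L, t}" for X
    using that by (meson finite.emptyI finite_insert negligible_finite finite_subset)
  have diff_T: "{0..L} - T \<subseteq> {0, L, t}" by (auto simp: T_def)
  define K where "K \<epsilon> s = kern F (velocity \<gamma> t + \<epsilon> *\<^sub>R velocity V t) (\<gamma> t - \<gamma> s + \<epsilon> *\<^sub>R (V t - V s))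
      (velocity \<gamma> s + \<epsilon> *\<^sub>R velocity V s) * \<sigma> s" for \<epsilon> s
  define K' where "K' \<epsilon> s = dkern F F' (velocity \<gamma> t + \<epsilon> *\<^sub>R velocity V t) (\<gamma> t - \<gamma> s + \<epsilon> *\<^sub>R (V t - V s))
      (velocity \<gamma> s + \<epsilon> *\<^sub>R velocity V s) (velocity V t) (V t - V s) (velocity V s) * \<sigma> s" for \<epsilon> s
  \<comment> \<open>The constants of \<open>norm_dkern_le\<close> and \<open>norm_kern_le\<close>,
    each multiplied by the bound \<open>A\<close> for the density.\<close>
  define C where "C = ((6 * B ^ 3 / c + 2 * B\<^sup>2) * M / c\<^sup>2 + 4 * B ^ 4 * M / c ^ 4) * A"
  define C0 where "C0 = 2 * B\<^sup>2 * M / c\<^sup>2 * A"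
  have chord_nz: "\<gamma> t - \<gamma> s + \<epsilon> *\<^sub>R (V t - V s) \<noteq> 0"
    and K_le: "norm (K \<epsilon> s) \<le> C0" and K'_le: "norm (K' \<epsilon> s) \<le> C"
    if \<epsilon>: "\<bar>\<epsilon>\<bar> < e" and s: "s \<in> T" for \<epsilon> s
  proof -
    have sL: "s \<in> {0..L}" using s T by auto
    obtain h where h: "h \<noteq> 0" "\<bar>h\<bar> \<le> L"
      and b: "norm ((\<gamma> t - \<gamma> s + \<epsilon> *\<^sub>R (V t - V s)) + h *\<^sub>R (velocity \<gamma> t + \<epsilon> *\<^sub>R velocity V t)) \<le> B * h\<^sup>2"
         "norm ((V t - V s) + h *\<^sub>R velocity V t) \<le> B * h\<^sup>2"
         "c * \<bar>h\<bar> \<le> norm (\<gamma> t - \<gamma> s + \<epsilon> *\<^sub>R (V t - V s))"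
         "norm (\<gamma> t - \<gamma> s + \<epsilon> *\<^sub>R (V t - V s)) \<le> B * \<bar>h\<bar>"
         "norm (V t - V s) \<le> B * \<bar>h\<bar>"
      using chord[OF \<epsilon> s[unfolded T_def]] by blast
    have "0 < c * \<bar>h\<bar>" using c h by simp
    then have pos: "0 < norm (\<gamma> t - \<gamma> s + \<epsilon> *\<^sub>R (V t - V s))" using b(3) by linarith
    then show "\<gamma> t - \<gamma> s + \<epsilon> *\<^sub>R (V t - V s) \<noteq> 0" by simp
    have "norm (\<gamma> t - \<gamma> s + \<epsilon> *\<^sub>R (V t - V s)) \<le> B * L"
      using b(4) mult_left_mono[OF h(2) B] by linarith
    then have "(norm (\<gamma> t - \<gamma> s + \<epsilon> *\<^sub>R (V t - V s)))\<^sup>2 \<in> {0<..(B * L)\<^sup>2}"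
      using pos by (auto intro: power_mono)
    note FM = M(2)[OF this]
    note vt = vel[OF \<epsilon> t] and vs = vel[OF \<epsilon> sL]
    show "norm (K \<epsilon> s) \<le> C0"
      unfolding K_def C0_def norm_mult
      by (intro mult_mono norm_kern_le[where h = h] A sL) (use c h b vt vs FM M in auto)
    show "norm (K' \<epsilon> s) \<le> C"
      unfolding K'_def C_def norm_mult
      by (intro mult_mono norm_dkern_le[where h = h] A sL) (use c h b vt vs FM M B in auto)
  qed
  have deriv: "((\<lambda>\<epsilon>. K \<epsilon> s) has_vector_derivative K' \<epsilon> s) (at \<epsilon>)" if \<epsilon>: "\<bar>\<epsilon>\<bar> < e" and s: "s \<in> T" for \<epsilon> s
    unfolding K_def K'_def
    using vel[OF \<epsilon> t] vel[OF \<epsilon>, of s] s T c chord_nz[OF that]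
    by (intro has_vector_derivative_mult_left has_vector_derivative_kern F) auto
  have cont: "continuous_on T (K \<epsilon>)" if \<epsilon>: "\<bar>\<epsilon>\<bar> < e" for \<epsilon>
  proof -
    have [continuous_intros]: "continuous_on T \<gamma>" "continuous_on T V" "continuous_on T \<sigma>"
      "continuous_on T (velocity \<gamma>)" "continuous_on T (velocity V)"
      using \<gamma>(1) V(1) \<sigma>
      by (simp_all add: velocity_def[abs_def] smooth_imp_continuous_on smooth_imp_continuous_on_deriv)
    have Fc: "continuous_on {0<..} F"
      using F by (intro continuous_at_imp_continuous_on) (auto intro: has_vector_derivative_continuous)
    have nv: "norm (velocity \<gamma> t + \<epsilon> *\<^sub>R velocity V t) \<noteq> 0" using vel[OF \<epsilon> t] c by linarith
    show ?thesis
      unfolding K_def kern_def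
      by (intro continuous_intros continuous_on_compose2[OF Fc] ballI nv) (use chord_nz[OF \<epsilon>] in auto)
  qed
  have absint_T: "K \<epsilon> absolutely_integrable_on T" if \<epsilon>: "\<bar>\<epsilon>\<bar> < e" for \<epsilon>
  proof (rule measurable_bounded_by_integrable_imp_absolutely_integrable)
    show "K \<epsilon> \<in> borel_measurable (lebesgue_on T)"
      by (rule continuous_imp_measurable_on_sets_lebesgue[OF cont[OF \<epsilon>] T(2)])
    show "(\<lambda>_. C0) integrable_on T"
      by (rule integrable_spike_set[of _ "{0..L}"]) (use T in \<open>auto intro!: null simp: T_def\<close>)
  qed (use T K_le \<epsilon> in auto)
  have eq: "S'_integrand k (perturbed \<gamma> V \<epsilon>) \<sigma> t s = K \<epsilon> s" if "\<bar>\<epsilon>\<bar> < e" "s \<in> T" for \<epsilon> s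
  proof -
    have d: "perturbed \<gamma> V \<epsilon> t - perturbed \<gamma> V \<epsilon> s = \<gamma> t - \<gamma> s + \<epsilon> *\<^sub>R (V t - V s)"
      by (simp add: perturbed_def algebra_simps)
    then have "perturbed \<gamma> V \<epsilon> t \<noteq> perturbed \<gamma> V \<epsilon> s" using chord_nz[OF that] by auto
    from S'_integrand_eq_kern[OF G E this] show ?thesis
      by (simp add: K_def d velocity_perturbed[OF \<gamma>(1) V(1)])
  qed
  have absint: "S'_integrand k (perturbed \<gamma> V \<epsilon>) \<sigma> t absolutely_integrable_on {0..L}"
    and integral_eq: "integral {0..L} (S'_integrand k (perturbed \<gamma> V \<epsilon>) \<sigma> t) = integral T (K \<epsilon>)"
    if \<epsilon>: "\<bar>\<epsilon>\<bar> < e" for \<epsilon>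
  proof -
    have "S'_integrand k (perturbed \<gamma> V \<epsilon>) \<sigma> t absolutely_integrable_on T"
      by (rule absolutely_integrable_spike[OF absint_T[OF \<epsilon>] negligible_empty]) (use eq[OF \<epsilon>] in auto)
    then show "S'_integrand k (perturbed \<gamma> V \<epsilon>) \<sigma> t absolutely_integrable_on {0..L}"
      by (rule absolutely_integrable_spike_set) (use T diff_T in \<open>auto intro!: null\<close>)
    have "integral {0..L} (S'_integrand k (perturbed \<gamma> V \<epsilon>) \<sigma> t)
        = integral T (S'_integrand k (perturbed \<gamma> V \<epsilon>) \<sigma> t)"
      by (rule integral_spike_set) (use T diff_T in \<open>auto intro!: null\<close>)
    also have "\<dots> = integral T (K \<epsilon>)" by (rule integral_cong) (rule eq[OF \<epsilon>])
    finally show "integral {0..L} (S'_integrand k (perturbed \<gamma> V \<epsilon>) \<sigma> t) = integral T (K \<epsilon>)" .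
  qed
  have pv: "has_pv_integral L (perturbed \<gamma> V \<epsilon>) t (S'_integrand k (perturbed \<gamma> V \<epsilon>) \<sigma> t) (integral T (K \<epsilon>))"
    if \<epsilon>: "\<bar>\<epsilon>\<bar> < e" for \<epsilon>
  proof -
    have "continuous_on {0..L} (perturbed \<gamma> V \<epsilon>)"
      unfolding perturbed_def[abs_def] using \<gamma>(1) V(1)
      by (intro continuous_intros) (simp_all add: smooth_imp_continuous_on)
    moreover have "perturbed \<gamma> V \<epsilon> s \<noteq> perturbed \<gamma> V \<epsilon> t" if "s \<in> T" for s
      using chord_nz[OF \<epsilon> that] by (auto simp: perturbed_def algebra_simps)
    then have "negligible {s \<in> {0..L}. perturbed \<gamma> V \<epsilon> s = perturbed \<gamma> V \<epsilon> t}"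
      using diff_T by (intro null) auto
    ultimately show ?thesis
      using has_pv_integral_absolutely_integrable[OF absint[OF \<epsilon>]] integral_eq[OF \<epsilon>] by metis
  qed
  have near: "\<forall>\<^sub>F \<epsilon> in nhds 0. \<bar>\<epsilon>\<bar> < e"
    using eventually_nhds_in_open[of "ball 0 e" "0::real"] e by (auto elim: eventually_mono)
  let ?U = "\<lambda>s. (U1 k \<gamma> V t s + U2 k \<gamma> V t s + U3 k \<gamma> V t s) * \<sigma> s * complex_of_real (speed \<gamma> s)"
  have U: "?U s = K' 0 s" if "s \<in> T" for s
  proof -
    have "\<gamma> t \<noteq> \<gamma> s" using chord_nz[OF _ that, of 0] e by auto
    from U_sum_eq_dkern[OF G E F this reg reg] show ?thesis by (simp add: K'_def mult_ac)
  qed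
  have "(\<lambda>_. C) integrable_on T"
    by (rule integrable_spike_set[of _ "{0..L}"]) (use T in \<open>auto intro!: null simp: T_def\<close>)
  note leibniz = leibniz_rule_dominated[OF e this, where f = K and f' = K' and ?x0.0 = 0]
  have K'0: "K' 0 absolutely_integrable_on T"
    by (rule leibniz(1)) (use deriv K'_le absint_T in \<open>auto intro: set_lebesgue_integral_eq_integral\<close>)
  have K_deriv: "((\<lambda>\<epsilon>. integral T (K \<epsilon>)) has_vector_derivative integral T (K' 0)) (at 0)"
    by (rule leibniz(2)) (use deriv K'_le absint_T in \<open>auto intro: set_lebesgue_integral_eq_integral\<close>)
  have "?U absolutely_integrable_on T"
    by (rule absolutely_integrable_spike[OF K'0 negligible_empty]) (use U in auto)
  then have U_int: "?U absolutely_integrable_on {0..L}"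
    by (rule absolutely_integrable_spike_set) (use T diff_T in \<open>auto intro!: null\<close>)
  have "integral {0..L} ?U = integral T ?U"
    by (rule integral_spike_set) (use T diff_T in \<open>auto intro!: null\<close>)
  also have "\<dots> = integral T (K' 0)" by (rule integral_cong) (rule U)
  finally have "((\<lambda>\<epsilon>. integral T (K \<epsilon>)) has_vector_derivative integral {0..L} ?U) (at 0)"
    using K_deriv by simp
  then have "((\<lambda>\<epsilon>. S' k L (perturbed \<gamma> V \<epsilon>) \<sigma> t) has_vector_derivative integral {0..L} ?U) (at 0)"
  \<comment> \<open>Existence of the principal value is established only for
    \<open>\<bar>\<epsilon>\<bar> < e\<close>. The definite description in
    \<open>pv_integral\<close> is therefore evaluated only on this ball, which is enough for a
    derivative at \<open>0\<close>.\<close>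
  proof (rule has_vector_derivative_transform_within_open[of _ _ _ "ball 0 e"])
    show "integral T (K \<epsilon>) = S' k L (perturbed \<gamma> V \<epsilon>) \<sigma> t" if "\<epsilon> \<in> ball 0 e" for \<epsilon>
      using pv_integral_eq[OF pv, of \<epsilon>] that by (simp add: S'_def)
  qed (use e in auto)
  with U_int near show ?thesis
    using pv by (auto elim!: eventually_mono)
qed

end
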